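(* Let $n\in\mathbb{N}$ and suppose that $M\subset\mathbb{R}^n$ has positive $n$-dimensional Lebesgue measure. Then the Banach space $\mathrm{Lip}_0(M)$ is linearly isomorphic to $\mathrm{Lip}_0(\mathbb{R}^n)$.
   Context: $\mathbb{R}^n$ carries its Euclidean (norm) metric, and subsets carry the restricted metric. Lipschitz space: for a metric space $(X,d)$ with a chosen base point $0\in X$, $\mathrm{Lip}_0(X)$ is the Banach space of all Lipschitz functions $f:X\to\mathbb{R}$ with $f(0)=0$, with norm $\|f\|_L=\sup\{\frac{f(x)-f(y)}{d(x,y)}: x\neq y\in X\}$. Different choices of base point give linearly isometric spaces, so the base point (any point of the metric space in question) is irrelevant here. "Linearly isomorphic" means that there is a bounded linear bijection with bounded inverse. *)

theory Defs
  imports "HOL-Analysis.Analysis"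
begin

text \<open>
  Functions on a subset \<open>X\<close> of a metric type are represented by total functions that vanish
  outside \<open>X\<close>. Every function on \<open>X\<close> has exactly one such representative, and the pointwise
  operations preserve this normal form. The metric of \<open>X\<close> is the restriction of \<^const>\<open>dist\<close>.
\<close>

definition Lip0 :: "'a::metric_space set \<Rightarrow> 'a \<Rightarrow> ('a \<Rightarrow> real) set" where
  "Lip0 X b = {f. (\<exists>L. L-lipschitz_on X f) \<and> f b = 0 \<and> (\<forall>x. x \<notin> X \<longrightarrow> f x = 0)}"

text \<open>
  If \<open>X\<close> has at least two points, inserting \<open>0\<close> does not change the supremum, since exchanging
  \<open>x\<close> and \<open>y\<close> changes the sign of the quotient. It only fixes the norm on a one-point space,
  where the supremum ranges over the empty set, to be \<open>0\<close>.
\<close>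

definition lip_norm :: "'a::metric_space set \<Rightarrow> ('a \<Rightarrow> real) \<Rightarrow> real" where
  "lip_norm X f = Sup (insert 0 {(f x - f y) / dist x y | x y. x \<in> X \<and> y \<in> X \<and> x \<noteq> y})"

text \<open>
  Below, \<open>V\<close> and \<open>W\<close> are spaces of real functions with pointwise operations, with norms \<open>N\<close>
  and \<open>K\<close>.
\<close>

definition bounded_linear_map ::
    "('a \<Rightarrow> real) set \<Rightarrow> (('a \<Rightarrow> real) \<Rightarrow> real) \<Rightarrow> ('b \<Rightarrow> real) set \<Rightarrow> (('b \<Rightarrow> real) \<Rightarrow> real) \<Rightarrow>
     (('a \<Rightarrow> real) \<Rightarrow> ('b \<Rightarrow> real)) \<Rightarrow> bool" where
  "bounded_linear_map V N W K T \<longleftrightarrow>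
     (\<forall>f\<in>V. T f \<in> W) \<and>
     (\<forall>f\<in>V. \<forall>g\<in>V. T (\<lambda>x. f x + g x) = (\<lambda>y. T f y + T g y)) \<and>
     (\<forall>c. \<forall>f\<in>V. T (\<lambda>x. c * f x) = (\<lambda>y. c * T f y)) \<and>
     (\<exists>C. \<forall>f\<in>V. K (T f) \<le> C * N f)"

definition linearly_isomorphic ::
    "('a \<Rightarrow> real) set \<Rightarrow> (('a \<Rightarrow> real) \<Rightarrow> real) \<Rightarrow> ('b \<Rightarrow> real) set \<Rightarrow> (('b \<Rightarrow> real) \<Rightarrow> real) \<Rightarrow> bool" where
  "linearly_isomorphic V N W K \<longleftrightarrow>
     (\<exists>T. bij_betw T V W \<and> bounded_linear_map V N W K T \<and>
          bounded_linear_map W K V N (inv_into V T))"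

end

theory Submission
  imports Defs "HOL-Library.Function_Algebras"
begin

text \<open>
  Let \<open>Z\<close> be the \<open>\<ell>\<^sub>\<infinity>\<close>-sum of countably many copies of \<open>Lip\<^sub>0(\<real>\<^sup>n)\<close>. By the
  decomposition method of Pelczynski, \<open>Lip\<^sub>0(M)\<close> is isomorphic to \<open>Z\<close> as soon as it is
  complemented in \<open>Lip\<^sub>0(\<real>\<^sup>n)\<close> and \<open>Z\<close> is complemented in it; the case \<open>M = \<real>\<^sup>n\<close> is
  included. The first projection comes from a bounded linear extension operator: compose \<open>f\<close> with an
  almost nearest point map, average over balls of radius \<open>max (infdist x M) \<epsilon>\<close>, and pass to an
  ultralimit as \<open>\<epsilon>\<close> tends to \<open>0\<close>. For the second, positive measure yields disjoint balls
  in which \<open>M\<close> is dense at ever finer relative scales. Rescaled truncations of each of countably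
  many functions are placed into infinitely many of these balls, and an ultralimit of blow-ups recovers
  every function from its copies.
\<close>

subsection \<open>Ultralimits\<close>

text \<open>Every operator must be linear in the function, with bounds uniform in it. This excludes
  the inf-formula that extends a single Lipschitz function, and also convergent subsequences, which
  would depend on the function; limits along one fixed ultrafilter are linear and exist for every
  bounded family. An almost nearest point map jumps, but only by amounts comparable to the distance
  to \<open>M\<close>; averaging at just that scale turns jumps into slopes, with a constant that
  depends on the dimension alone. A set of positive measure may contain no ball, so no ball carries
  an exact copy of a function on the whole space. Approximate copies suffice because they improve
  along infinitely many balls: the rescaled windows grow and the mesh of \<open>M\<close> in them
  shrinks. A function with \<open>f 0 = 0\<close> and Lipschitz constant \<open>L\<close> is at most
  \<open>L * R\<close> on a ball of radius \<open>R\<close>, so cutting it off with slope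
  \<open>1 / R\<close> costs only a factor 2.\<close>

definition ultra :: "'a filter \<Rightarrow> bool" where
  "ultra F \<longleftrightarrow> F \<noteq> bot \<and> (\<forall>P. eventually P F \<or> eventually (\<lambda>x. \<not> P x) F)"

text \<open>Zorn's lemma for the reversed order: a minimal proper filter below \<open>F\<close>
  decides every predicate \<open>P\<close>, since restricting it to \<open>P\<close> either makes it
  improper or leaves it unchanged.\<close>

lemma ex_ultra_le:
  assumes "F \<noteq> (bot :: 'a filter)"
  shows "\<exists>U\<le>F. ultra U"
proof -
  define A where "A = {G. G \<noteq> bot \<and> G \<le> F}"
  have "\<exists>m\<in>A. \<forall>a\<in>A. m \<ge> a \<longrightarrow> a = m"
  proof (rule predicate_Zorn)
    show "partial_order_on A (relation_of (\<ge>) A)"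
      by (rule partial_order_on_relation_ofI) auto
  next
    fix C assume C: "C \<in> Chains (relation_of (\<ge>) A)"
    show "\<exists>u\<in>A. \<forall>a\<in>C. a \<ge> u"
    proof (cases "C = {}")
      case True
      then show ?thesis using assms by (auto simp: A_def)
    next
      case False
      have sub: "C \<subseteq> A" using C by (auto simp: Chains_def relation_of_def)
      \<comment> \<open>The infimum of two members of a chain is one of them, so \<open>C\<close> is
        a filter base and \<open>Inf C\<close> stays proper.\<close>
      have ch: "\<exists>x\<in>C. x \<le> inf G H" if "G \<in> C" "H \<in> C" for G H
        using C that by (auto simp: Chains_def relation_of_def inf_absorb1 inf_absorb2)
      have "eventually P (Inf C) \<longleftrightarrow> (\<exists>b\<in>C. eventually P b)" for P
        by (rule eventually_Inf_base[OF False ch])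
      then have "Inf C \<noteq> bot"
        using sub by (auto simp: trivial_limit_def A_def)
      moreover have "Inf C \<le> F"
        using False sub by (auto simp: A_def intro: Inf_lower2)
      ultimately show ?thesis by (intro bexI[of _ "Inf C"]) (auto simp: A_def Inf_lower)
    qed
  qed
  then obtain U where U: "U \<noteq> bot" "U \<le> F" and max: "\<And>G. G \<noteq> bot \<Longrightarrow> G \<le> U \<Longrightarrow> G = U"
    unfolding A_def by (auto intro: order_trans)
  have "eventually P U \<or> eventually (\<lambda>x. \<not> P x) U" for P
  proof (cases "inf U (principal {x. P x}) = bot")
    case True
    then show ?thesis by (auto simp: trivial_limit_def eventually_inf_principal)
  next
    case False
    then have "inf U (principal {x. P x}) = U" by (intro max) auto
    then have "U \<le> principal {x. P x}" by (metis inf.cobounded2)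
    then show ?thesis by (simp add: le_principal)
  qed
  then show ?thesis using U by (auto simp: ultra_def)
qed

text \<open>Compactness of \<open>{-C..C}\<close> supplies a cluster point, and an ultrafilter
  converges to its cluster points. So \<open>Lim U\<close> is a genuine limit on bounded functions,
  hence linear and monotone there.\<close>

lemma ultra_bounded_tendsto:
  fixes u :: "'a \<Rightarrow> real"
  assumes U: "ultra U" and bd: "eventually (\<lambda>k. \<bar>u k\<bar> \<le> C) U"
  shows "(u \<longlongrightarrow> Lim U u) U"
proof -
  have U0: "U \<noteq> bot" using U by (simp add: ultra_def)
  have "filtermap u U \<noteq> bot" using U0 by (simp add: filtermap_bot_iff)
  moreover have "eventually (\<lambda>x. x \<in> {-C..C}) (filtermap u U)"
    unfolding eventually_filtermap using bd by (rule eventually_mono) (auto simp: abs_le_iff)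
  ultimately obtain l where l: "inf (nhds l) (filtermap u U) \<noteq> bot"
    using compact_Icc[of "-C" C] unfolding compact_filter by (auto simp: le_principal)
  have "(u \<longlongrightarrow> l) U"
  proof (rule topological_tendstoI)
    fix S assume S: "open S" "l \<in> S"
    have "\<not> eventually (\<lambda>k. u k \<notin> S) U"
    proof
      assume "eventually (\<lambda>k. u k \<notin> S) U"
      then have "eventually (\<lambda>x. x \<notin> S) (filtermap u U)" by (simp add: eventually_filtermap)
      moreover have "eventually (\<lambda>x. x \<in> S) (nhds l)" using S by (rule eventually_nhds_in_open)
      ultimately have "eventually (\<lambda>x. False) (inf (nhds l) (filtermap u U))"
        unfolding eventually_inf by blast
      then show False using l by (simp add: trivial_limit_def)
    qed
    then show "eventually (\<lambda>k. u k \<in> S) U" using U unfolding ultra_def by blast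
  qed
  then show ?thesis using U0 by (simp add: tendsto_Lim)
qed

subsection \<open>Linear extension of Lipschitz functions\<close>

text \<open>After scaling to radius 1 this bounds the volume of the shell between two concentric
  balls by a multiple of its thickness.\<close>

lemma power_diff_linear_bound:
  obtains c where "c > 0" "\<And>s. 0 \<le> s \<Longrightarrow> s \<le> 1 \<Longrightarrow> (1 + s) ^ n - (1 - s) ^ n \<le> c * (s::real)"
proof -
  \<comment> \<open>The estimate itself yields \<open>2 * n * 2 ^ n\<close>; adding 1 keeps the
    constant positive for \<open>n = 0\<close>.\<close>
  have "(1 + s) ^ n - (1 - s) ^ n \<le> (2 * real n * 2 ^ n + 1) * s" if s: "0 \<le> s" "s \<le> 1" for s :: real
  proof -
    have "(1 + s) ^ n - (1 - s) ^ n = 2 * s * (\<Sum>i<n. (1 - s) ^ (n - Suc i) * (1 + s) ^ i)"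
      by (simp add: power_diff_sumr2)
    also have "(\<Sum>i<n. (1 - s) ^ (n - Suc i) * (1 + s) ^ i) \<le> (\<Sum>i<n. 2 ^ n)"
    proof (rule sum_mono)
      fix i assume "i \<in> {..<n}"
      have "(1 - s) ^ (n - Suc i) * (1 + s) ^ i \<le> 1 * (1 + s) ^ i"
        using s by (intro mult_right_mono power_le_one) auto
      also have "\<dots> \<le> 1 * 2 ^ i"
        using s by (intro mult_left_mono power_mono) auto
      also have "\<dots> \<le> (2::real) ^ n" using \<open>i \<in> {..<n}\<close> by simp
      finally show "(1 - s) ^ (n - Suc i) * (1 + s) ^ i \<le> 2 ^ n" .
    qed
    then have "2 * s * (\<Sum>i<n. (1 - s) ^ (n - Suc i) * (1 + s) ^ i) \<le> 2 * s * (\<Sum>i<n. 2 ^ n)"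
      using s by (intro mult_left_mono) auto
    also have "\<dots> \<le> (2 * real n * 2 ^ n + 1) * s" using s by (simp add: algebra_simps)
    finally show ?thesis by simp
  qed
  then show ?thesis by (intro that[of "2 * real n * 2 ^ n + 1"]) (auto intro: add_nonneg_pos)
qed

definition ball_avg :: "('a::euclidean_space \<Rightarrow> real) \<Rightarrow> 'a \<Rightarrow> real \<Rightarrow> real" where
  "ball_avg g x r = (LINT z:ball x r|lborel. g z) / measure lborel (ball x r)"

lemma set_integrable_const_ball:
  "set_integrable lborel (ball (x::'a::euclidean_space) r) (\<lambda>_. c::real)"
  unfolding set_integrable_def
  by (intro integrable_scaleR_left integrable_real_indicator) (simp_all add: emeasure_lborel_ball_finite[unfolded infinity_ennreal_def])

lemma ball_integrable:
  fixes g :: "'a::euclidean_space \<Rightarrow> real"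
  assumes "g \<in> borel_measurable borel" "\<And>z. z \<in> ball x r \<Longrightarrow> \<bar>g z - c\<bar> \<le> K"
  shows "set_integrable lborel (ball x r) g"
proof (rule set_integrable_bound[where f="\<lambda>_. \<bar>c\<bar> + K"])
  show "set_integrable lborel (ball x r) (\<lambda>_. \<bar>c\<bar> + K)"
    by (rule set_integrable_const_ball)
  show "set_borel_measurable lborel (ball x r) g"
    unfolding set_borel_measurable_def using assms(1)
    by (intro borel_measurable_scaleR borel_measurable_indicator) simp_all
  show "AE z in lborel. z \<in> ball x r \<longrightarrow> norm (g z) \<le> norm (\<bar>c\<bar> + K)"
    using assms(2) by (intro AE_I2) fastforce
qed

lemma measure_ball_scale:
  assumes "0 \<le> r"
  shows "measure lborel (ball (x::'a::euclidean_space) r) = r ^ DIM('a) * measure lborel (ball (0::'a) 1)"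
  using content_ball_conv_unit_ball[OF assms, of x] by (simp add: measure_completion)

lemma measure_unit_ball_pos: "0 < measure lborel (ball (0::'a::euclidean_space) 1)"
  using content_ball_pos[of 1 "0::'a"] by (simp add: measure_completion)

lemma ball_avg_diff_const:
  fixes g :: "'a::euclidean_space \<Rightarrow> real"
  assumes "g \<in> borel_measurable borel" "\<And>z. z \<in> ball x r \<Longrightarrow> \<bar>g z - c\<bar> \<le> K" "r > 0"
  shows "ball_avg (\<lambda>z. g z - c) x r = ball_avg g x r - c"
proof -
  have "measure lborel (ball x r) > 0"
    using measure_ball_scale[of r x] measure_unit_ball_pos[where 'a='a] assms(3) by simp
  moreover have "set_integrable lborel (ball x r) (\<lambda>_. c)"
    by (rule set_integrable_const_ball)
  ultimately show ?thesis
    unfolding ball_avg_def 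
    by (subst set_integral_diff) (auto intro: ball_integrable[OF assms(1,2)] simp: diff_divide_distrib
      set_lebesgue_integral_def)
qed

lemma ball_avg_bound:
  fixes g :: "'a::euclidean_space \<Rightarrow> real"
  assumes g: "g \<in> borel_measurable borel" and K: "\<And>z. z \<in> ball x r \<Longrightarrow> \<bar>g z - c\<bar> \<le> K" and r: "r > 0"
  shows "\<bar>ball_avg g x r - c\<bar> \<le> K"
proof -
  have pos: "measure lborel (ball x r) > 0"
    using measure_ball_scale[of r x] measure_unit_ball_pos[where 'a='a] r by simp
  have ig: "set_integrable lborel (ball x r) (\<lambda>z. g z - c)"
    by (rule ball_integrable[where c=0 and K=K]) (use g K in auto)
  have iK: "set_integrable lborel (ball x r) (\<lambda>_. K)"
    by (rule set_integrable_const_ball)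
  have "\<bar>LINT z:ball x r|lborel. g z - c\<bar> \<le> (LINT z:ball x r|lborel. \<bar>g z - c\<bar>)"
    using set_integral_norm_bound[OF ig] by simp
  also have "\<dots> \<le> (LINT z:ball x r|lborel. K)"
    by (rule set_integral_mono) (use ig iK K in \<open>auto intro: set_integrable_abs\<close>)
  also have "\<dots> = K * measure lborel (ball x r)" by (simp add: set_lebesgue_integral_def)
  finally have "\<bar>ball_avg (\<lambda>z. g z - c) x r\<bar> \<le> K"
    using pos by (simp add: ball_avg_def field_simps)
  then show ?thesis using ball_avg_diff_const[of g x r c K] g K r by simp
qed

text \<open>The two integrals differ only on the symmetric difference of \<open>A\<close> and
  \<open>B\<close>, which lies in \<open>O' - I\<close>.\<close>

lemma set_integral_nested_diff:
  fixes g :: "'a \<Rightarrow> real"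
  assumes AB: "set_integrable M A g" "set_integrable M B g" "A \<in> sets M" "B \<in> sets M"
    and sub: "I \<subseteq> A" "I \<subseteq> B" "A \<subseteq> O'" "B \<subseteq> O'" "I \<in> fmeasurable M" "O' \<in> fmeasurable M"
    and K: "\<And>z. z \<in> O' \<Longrightarrow> \<bar>g z\<bar> \<le> K"
  shows "\<bar>(LINT z:A|M. g z) - (LINT z:B|M. g z)\<bar> \<le> K * (measure M O' - measure M I)"
proof -
  have "(LINT z:A|M. g z) - (LINT z:B|M. g z) = (LINT z|M. indicator A z * g z - indicator B z * g z)"
    using AB by (simp add: set_lebesgue_integral_def set_integrable_def)
  also have "\<bar>\<dots>\<bar> \<le> (LINT z|M. \<bar>indicator A z * g z - indicator B z * g z\<bar>)"
    by (rule integral_abs_bound)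
  also have "\<dots> \<le> (LINT z|M. K * (indicator O' z - indicator I z))"
  proof (rule integral_mono)
    show "integrable M (\<lambda>z. \<bar>indicator A z * g z - indicator B z * g z\<bar>)"
      using AB by (simp add: set_integrable_def)
    show "integrable M (\<lambda>z. K * (indicator O' z - indicator I z :: real))"
      using sub(5,6) by (auto simp: fmeasurable_def)
    fix z show "\<bar>indicator A z * g z - indicator B z * g z\<bar> \<le> K * (indicator O' z - indicator I z)"
      using K[of z] sub(1-4) by (auto simp: indicator_def)
  qed
  also have "\<dots> = K * (measure M O' - measure M I)"
    using sub(5,6) by (simp add: fmeasurable_def)
  finally show ?thesis .
qed

text \<open>The hypothesis on \<open>g\<close> tolerates jumps as large as the radius of averaging;
  composition with an almost nearest point map produces exactly such jumps. \<open>K0\<close> is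
  obtained before \<open>g\<close>, \<open>\<rho>\<close> and \<open>L\<close>, so that one constant
  serves a whole sequence of radius functions.\<close>

lemma ball_avg_lipschitz:
  obtains K0 where "K0 \<ge> 0"
    "\<And>(g :: 'a::euclidean_space \<Rightarrow> real) \<rho> L. \<lbrakk>g \<in> borel_measurable borel; 1-lipschitz_on UNIV \<rho>; \<And>x. \<rho> x > 0; L \<ge> 0;
      \<And>z w. \<bar>g z - g w\<bar> \<le> L * (dist z w + 2 * \<rho> z + 2 * \<rho> w)\<rbrakk> \<Longrightarrow>
      (K0 * L)-lipschitz_on UNIV (\<lambda>x. ball_avg g x (\<rho> x))"
proof -
  obtain c0 where c0: "c0 > 0" 
    "\<And>s. 0 \<le> s \<Longrightarrow> s \<le> 1 \<Longrightarrow> (1 + s) ^ DIM('a) - (1 - s) ^ DIM('a) \<le> c0 * (s::real)"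
    using power_diff_linear_bound by blast
  have main: "\<bar>ball_avg g x (\<rho> x) - ball_avg g y (\<rho> y)\<bar> \<le> (82 + 40 * c0) * L * dist x y"
    if g: "g \<in> borel_measurable borel" and lip: "1-lipschitz_on UNIV \<rho>" and pos: "\<And>x. \<rho> x > 0" and L: "L \<ge> 0"
      and coarse: "\<And>z w. \<bar>g z - g w\<bar> \<le> L * (dist z w + 2 * \<rho> z + 2 * \<rho> w)"
    for g :: "'a \<Rightarrow> real" and \<rho> L x y
  proof -
    define h where "h = dist x y"
    have h0: "h \<ge> 0" by (simp add: h_def)
    have \<rho>: "\<bar>\<rho> z - \<rho> w\<bar> \<le> dist z w" for z w
      using lipschitz_onD[OF lip, of z w] by (simp add: dist_real_def)
    \<comment> \<open>By \<open>\<rho> w \<le> \<rho> z + dist z w\<close> the coefficients become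
      \<open>1 + 2\<close> and \<open>2 + 2\<close>; on the ball of radius \<open>\<rho> z\<close>
      they add up to the 7 of \<open>avg\<close>.\<close>
    have near: "\<bar>g w - g z\<bar> \<le> L * (3 * dist z w + 4 * \<rho> z)" for z w
      using order_trans[OF coarse[of w z] mult_left_mono[OF _ L]] \<rho>[of z w] by (auto simp: dist_commute)
    have avg: "\<bar>ball_avg g z (\<rho> z) - g z\<bar> \<le> L * (7 * \<rho> z)" for z
    proof (rule ball_avg_bound[OF g _ pos])
      fix w assume "w \<in> ball z (\<rho> z)"
      then show "\<bar>g w - g z\<bar> \<le> L * (7 * \<rho> z)"
        by (intro order_trans[OF near mult_left_mono[OF _ L]]) auto
    qed
    show ?thesis
      \<comment> \<open>If the points are close compared to the radius, both balls lie between two concentric balls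
        whose volumes differ by a multiple of \<open>h / r\<close>, and \<open>g - g x\<close> has size \<open>L * r\<close> there.\<close>
    proof (cases "\<rho> x \<le> 4 * h")
      case True
      have "\<rho> y \<le> 5 * h" using \<rho>[of x y] True by (simp add: h_def)
      have "\<bar>ball_avg g x (\<rho> x) - ball_avg g y (\<rho> y)\<bar> \<le> L * (7 * \<rho> x) + L * (h + 2 * \<rho> x + 2 * \<rho> y) + L * (7 * \<rho> y)"
        using avg[of x] avg[of y] coarse[of x y] unfolding h_def by linarith
      also have "\<dots> = L * (9 * \<rho> x + 9 * \<rho> y + h)" by (simp add: algebra_simps)
      \<comment> \<open>From \<open>\<rho> x \<le> 4 * h\<close> and
        \<open>\<rho> y \<le> 5 * h\<close>: \<open>36 + 45 + 1 = 82\<close>.\<close>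
      also have "\<dots> \<le> L * (82 * h)"
        using True \<open>\<rho> y \<le> 5 * h\<close> by (intro mult_left_mono[OF _ L]) simp
      also have "\<dots> \<le> (82 + 40 * c0) * L * h"
        using c0(1) L h0 by (simp add: algebra_simps)
      finally show ?thesis by (simp add: h_def)
    next
      case False
      define r r' where "r = \<rho> x" and "r' = \<rho> y"
      have r: "r > 0" "r' > 0" "4 * h < r" "r' \<le> r + h" "r \<le> r' + h"
        using pos False \<rho>[of x y] by (auto simp: r_def r'_def h_def)
      \<comment> \<open>On the outer ball \<open>dist x z < r + 2 * h < 3 / 2 * r\<close>, so
        \<open>near\<close> gives at most \<open>8.5 * L * r\<close>, rounded up here.\<close>
      define K where "K = L * (10 * r)"
      define \<omega> where "\<omega> = measure lborel (ball (0::'a) 1)"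
      have \<omega>: "\<omega> > 0" unfolding \<omega>_def by (rule measure_unit_ball_pos)
      define f where "f = (\<lambda>z. g z - g x)"
      define a b where "a = (LINT z:ball x r|lborel. f z)" and "b = (LINT z:ball y r'|lborel. f z)"
      define v v' D where "v = r ^ DIM('a) * \<omega>" and "v' = r' ^ DIM('a) * \<omega>" 
        and "D = ((r + 2 * h) ^ DIM('a) - (r - 2 * h) ^ DIM('a)) * \<omega>"
      have v: "v > 0" "v' > 0" using r \<omega> by (auto simp: v_def v'_def)
      have sub: "ball x (r - 2 * h) \<subseteq> ball x r" "ball x r \<subseteq> ball x (r + 2 * h)" "ball x (r - 2 * h) \<subseteq> ball y r'" 
        "ball y r' \<subseteq> ball x (r + 2 * h)"
        using r h0 by (auto simp: ball_subset_ball_iff h_def dist_commute)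
      have fK: "\<bar>f z\<bar> \<le> K" if "z \<in> ball x (r + 2 * h)" for z
        unfolding f_def K_def using that r
        by (intro order_trans[OF near mult_left_mono[OF _ L]]) (auto simp: r_def)
      have fm: "f \<in> borel_measurable borel" unfolding f_def using g by simp
      have meas: "measure lborel (ball z s) = s ^ DIM('a) * \<omega>" if "s \<ge> 0" for z :: 'a and s
        using measure_ball_scale[OF that, of z] by (simp add: \<omega>_def)
      have D: "\<bar>a - b\<bar> \<le> K * D"
      proof -
        have "\<bar>a - b\<bar> \<le> K * (measure lborel (ball x (r + 2 * h)) - measure lborel (ball x (r - 2 * h)))"
          unfolding a_def b_def
        proof (rule set_integral_nested_diff)
          show "set_integrable lborel (ball x r) f" "set_integrable lborel (ball y r') f"
            using sub fK by (auto intro!: ball_integrable[OF fm, where c=0 and K=K])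
        qed (use sub fK in \<open>auto simp: fmeasurable_def emeasure_lborel_ball_finite[unfolded infinity_ennreal_def]\<close>)
        then show ?thesis using r h0 by (simp add: meas D_def algebra_simps)
      qed
      have vv: "\<bar>v' - v\<bar> \<le> D"
      proof -
        have "r ^ DIM('a) \<le> (r + 2 * h) ^ DIM('a)" "(r - 2 * h) ^ DIM('a) \<le> r ^ DIM('a)"
          "r' ^ DIM('a) \<le> (r + 2 * h) ^ DIM('a)" "(r - 2 * h) ^ DIM('a) \<le> r' ^ DIM('a)"
          using r h0 by (auto intro!: power_mono)
        then have "\<bar>r' ^ DIM('a) - r ^ DIM('a)\<bar> \<le> (r + 2 * h) ^ DIM('a) - (r - 2 * h) ^ DIM('a)" by linarith
        then show ?thesis using \<omega> unfolding v_def v'_def D_def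
          by (simp flip: left_diff_distrib add: abs_mult)
      qed
      have "\<bar>ball_avg f y r' - 0\<bar> \<le> K"
        by (rule ball_avg_bound[OF fm _ r(2)]) (use sub fK in auto)
      moreover have "ball_avg f y r' = b / v'"
        using r by (simp add: ball_avg_def b_def meas v'_def)
      ultimately have b: "\<bar>b / v'\<bar> \<le> K" by simp
      have K0: "K \<ge> 0" using L r by (simp add: K_def)
      have "ball_avg g x r - ball_avg g y r' = ball_avg f x r - ball_avg f y r'"
      proof -
        have "ball_avg f x r = ball_avg g x r - g x" "ball_avg f y r' = ball_avg g y r' - g x"
          unfolding f_def using sub fK g r
          by (auto intro!: ball_avg_diff_const[where K=K] simp: f_def)
        then show ?thesis by simp
      qed
      \<comment> \<open>The first term is the change of the domain of integration, the second the
        change of the normalizing volume; the shell volume \<open>D\<close> controls both.\<close>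
      also have "\<dots> = (a - b) / v + (b / v') * ((v' - v) / v)"
      proof -
        have "ball_avg f x r = a / v" "ball_avg f y r' = b / v'"
          using r by (simp_all add: ball_avg_def a_def b_def meas v_def v'_def)
        then show ?thesis using v by (simp add: field_simps)
      qed
      also have "\<bar>\<dots>\<bar> \<le> K * D / v + K * (D / v)"
      proof -
        have "\<bar>(a - b) / v\<bar> \<le> K * D / v" using D v by (simp add: divide_right_mono)
        moreover note b
        moreover have "\<bar>(v' - v) / v\<bar> \<le> D / v" using vv v by (simp add: divide_right_mono)
        ultimately have "\<bar>(b / v') * ((v' - v) / v)\<bar> \<le> K * (D / v)"
          unfolding abs_mult using K0 by (intro mult_mono) auto
        then show ?thesis using \<open>\<bar>(a - b) / v\<bar> \<le> K * D / v\<close> by linarith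
      qed
      also have "D / v = (1 + 2 * h / r) ^ DIM('a) - (1 - 2 * h / r) ^ DIM('a)"
      proof -
        have *: "(1 + 2 * h / r) = (r + 2 * h) / r" "(1 - 2 * h / r) = (r - 2 * h) / r" 
          using r by (simp_all add: field_simps)
        show ?thesis unfolding * power_divide D_def v_def using \<omega> by (simp add: diff_divide_distrib)
      qed
      also have "K * D / v = K * (D / v)" by simp
      also have "D / v = (1 + 2 * h / r) ^ DIM('a) - (1 - 2 * h / r) ^ DIM('a)"
        by fact
      also have "K * ((1 + 2 * h / r) ^ DIM('a) - (1 - 2 * h / r) ^ DIM('a)) +
         K * ((1 + 2 * h / r) ^ DIM('a) - (1 - 2 * h / r) ^ DIM('a)) \<le> K * (c0 * (2 * h / r)) + K * (c0 * (2 * h / r))"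
        using r h0 by (intro add_mono mult_left_mono[OF _ K0] c0(2)) (auto simp: field_simps)
      \<comment> \<open>The factor \<open>r\<close> in \<open>K\<close> cancels the
        \<open>1 / r\<close> of the relative shell volume: this is the gain from averaging at the
        scale of the jumps.\<close>
      also have "\<dots> = 40 * c0 * L * h" using r by (simp add: K_def)
      also have "\<dots> \<le> (82 + 40 * c0) * L * h"
        using L h0 by (simp add: algebra_simps)
      finally show ?thesis by (simp add: h_def r_def r'_def)
    qed
  qed
  show ?thesis
  proof (rule that[of "82 + 40 * c0"])
    show "((82 + 40 * c0) * L)-lipschitz_on UNIV (\<lambda>x. ball_avg g x (\<rho> x))"
      if "g \<in> borel_measurable borel" "1-lipschitz_on UNIV \<rho>" "\<And>x. \<rho> x > 0" "L \<ge> 0"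
        "\<And>z w. \<bar>g z - g w\<bar> \<le> L * (dist z w + 2 * \<rho> z + 2 * \<rho> w)"
      for g :: "'a \<Rightarrow> real" and \<rho> L
      using main[OF that] c0(1) that(4) by (intro lipschitz_onI) (auto simp: dist_real_def)
  qed (use c0 in auto)
qed

section \<open>Almost nearest points and approximate extension operators\<close>

lemma infdist_lipschitz: "1-lipschitz_on UNIV (\<lambda>x. infdist x A)"
proof (rule lipschitz_onI)
  fix x y
  show "dist (infdist x A) (infdist y A) \<le> 1 * dist x y"
    using infdist_triangle[of x A y] infdist_triangle[of y A x] by (auto simp: dist_real_def dist_commute)
qed simp

text \<open>Values of \<open>p\<close> are taken in a countable dense subset to make every \<open>f \<circ> p\<close> measurable.\<close>

lemma ex_measurable_near_point:
  fixes M :: "'a::euclidean_space set"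
  assumes "M \<noteq> {}" "\<And>x. infdist x M < R x" "continuous_on UNIV R"
  obtains p where "\<And>x. p x \<in> M" "\<And>x. dist x (p x) < R x"
    "\<And>f :: 'a \<Rightarrow> real. (\<lambda>x. f (p x)) \<in> borel_measurable borel"
proof -
  obtain D where D: "countable D" "D \<subseteq> M" "M \<subseteq> closure D"
    using separable by blast
  have D0: "D \<noteq> {}" using D assms(1) by auto
  define d where "d = from_nat_into D"
  define idx where "idx = (\<lambda>x. LEAST j. dist x (d j) < R x)"
  have "\<exists>j. dist x (d j) < R x" for x
  proof -
    have "\<exists>m\<in>M. dist x m < R x"
      using assms(1) assms(2)[of x] by (auto simp: infdist_def cInf_less_iff)
    then obtain m where m: "m \<in> M" "dist x m < R x" by blast
    have "m \<in> closure D" using m(1) D(3) by blast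
    then have "\<exists>q\<in>D. dist q m < R x - dist x m"
      unfolding closure_approachable using m(2) by simp
    then obtain q where "q \<in> D" "dist q m < R x - dist x m" by blast
    moreover from this have "dist x q < R x"
      using dist_triangle[of x q m] by (simp add: dist_commute)
    ultimately have "\<exists>q\<in>D. dist x q < R x" by blast
    then show ?thesis
      using from_nat_into_surj[OF D(1)] unfolding d_def by metis
  qed
  then have idx: "dist x (d (idx x)) < R x" for x
    unfolding idx_def by (metis (mono_tags, lifting) LeastI_ex)
  show ?thesis
  proof (rule that[of "\<lambda>x. d (idx x)"])
    show "d (idx x) \<in> M" for x
      using from_nat_into[OF D0] D(2) by (auto simp: d_def)
    show "dist x (d (idx x)) < R x" for x by (rule idx)
    fix f :: "'a \<Rightarrow> real"
    have Rm: "R \<in> borel_measurable borel" using assms(3) by (rule borel_measurable_continuous_onI)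
    \<comment> \<open>\<open>idx x = j\<close> is decided by finitely many measurable conditions on
      \<open>x\<close>, so choosing the least index is measurable.\<close>
    have "idx \<in> measurable borel (count_space UNIV)"
      unfolding idx_def using Rm by measurable
    then show "(\<lambda>x. f (d (idx x))) \<in> borel_measurable borel"
      by (rule measurable_compose) simp
  qed
qed

text \<open>Extension up to an error of order \<open>\<epsilon>\<close>. \<open>K\<close> is a
  parameter because it must not deteriorate as \<open>\<epsilon>\<close> tends to \<open>0\<close>.
  Additivity is asked for Lipschitz functions, whose averages exist; scaling commutes with the
  integral in any case.\<close>

definition smoothed_extension ::
    "real \<Rightarrow> 'a::metric_space set \<Rightarrow> real \<Rightarrow> (('a \<Rightarrow> real) \<Rightarrow> ('a \<Rightarrow> real)) \<Rightarrow> bool" where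
  "smoothed_extension K M \<epsilon> E \<longleftrightarrow>
     (\<forall>f L. L-lipschitz_on M f \<longrightarrow> (K * L)-lipschitz_on UNIV (E f) \<and> (\<forall>x\<in>M. \<bar>E f x - f x\<bar> \<le> 5 * L * \<epsilon>)) \<and>
     (\<forall>f g L L'. L-lipschitz_on M f \<longrightarrow> L'-lipschitz_on M g \<longrightarrow> E (\<lambda>x. f x + g x) = (\<lambda>x. E f x + E g x)) \<and>
     (\<forall>f c. E (\<lambda>x. c * f x) = (\<lambda>x. c * E f x))"

lemma ex_smoothed_extension:
  obtains K :: real where "K \<ge> 0"
   "\<And>(M :: 'a::euclidean_space set) \<epsilon>. M \<noteq> {} \<Longrightarrow> \<epsilon> > 0 \<Longrightarrow> 
      \<exists>E. smoothed_extension K M \<epsilon> E"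
proof -
  obtain K where K: "K \<ge> 0"
    "\<And>(g :: 'a \<Rightarrow> real) \<rho> L. \<lbrakk>g \<in> borel_measurable borel; 1-lipschitz_on UNIV \<rho>; \<And>x. \<rho> x > 0; L \<ge> 0;
      \<And>z w. \<bar>g z - g w\<bar> \<le> L * (dist z w + 2 * \<rho> z + 2 * \<rho> w)\<rbrakk> \<Longrightarrow>
      (K * L)-lipschitz_on UNIV (\<lambda>x. ball_avg g x (\<rho> x))"
    by (rule ball_avg_lipschitz) blast
  have ex: "\<exists>E. smoothed_extension K M \<epsilon> E"
    if M: "M \<noteq> {}" and \<epsilon>: "\<epsilon> > 0" for M :: "'a set" and \<epsilon>
  proof -
    \<comment> \<open>Far from \<open>M\<close> the radius is the size of the jumps of
      \<open>p\<close>; on \<open>M\<close> that size vanishes and \<open>\<epsilon>\<close> keeps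
      the balls nondegenerate.\<close>
    define \<rho> where "\<rho> = (\<lambda>x. max (infdist x M) \<epsilon>)"
    have \<rho>0: "\<rho> x > 0" for x using \<epsilon> by (simp add: \<rho>_def)
    have \<rho>d: "\<bar>\<rho> x - \<rho> y\<bar> \<le> dist x y" for x y
      using lipschitz_onD[OF infdist_lipschitz[of M], of x y] by (auto simp: \<rho>_def dist_real_def)
    have \<rho>l: "1-lipschitz_on UNIV \<rho>"
      using \<rho>d by (intro lipschitz_onI) (auto simp: dist_real_def)
    obtain p where p: "\<And>x. p x \<in> M" "\<And>x. dist x (p x) < 2 * \<rho> x"
      "\<And>f :: 'a \<Rightarrow> real. (\<lambda>x. f (p x)) \<in> borel_measurable borel"
    proof (rule ex_measurable_near_point[OF M])
      show "infdist x M < 2 * \<rho> x" for x using \<epsilon> infdist_nonneg[of x M] by (auto simp: \<rho>_def)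
      show "continuous_on UNIV (\<lambda>x. 2 * \<rho> x)"
        using lipschitz_on_continuous_on[OF \<rho>l] by (intro continuous_intros)
    qed blast
    \<comment> \<open>\<open>p z\<close> is within \<open>2 * \<rho> z \<le> 4 * \<rho> x\<close> of
      \<open>z\<close>, and \<open>z\<close> is within \<open>\<rho> x\<close> of \<open>x\<close>:
      hence the 5.\<close>
    have near: "dist (p z) y \<le> dist x y + 5 * \<rho> x" if "z \<in> ball x (\<rho> x)" for x y z
    proof -
      have "dist (p z) y \<le> dist z (p z) + dist x z + dist x y"
        using dist_triangle[of "p z" y z] dist_triangle[of z y x] by (simp add: dist_commute)
      moreover have "\<rho> z \<le> 2 * \<rho> x" using \<rho>d[of z x] that by (simp add: dist_commute)
      ultimately show ?thesis using p(2)[of z] that by simp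
    qed
    have bd: "\<bar>f (p z) - f y\<bar> \<le> L * (dist x y + 5 * \<rho> x)" 
      if "L-lipschitz_on M f" "y \<in> M" "z \<in> ball x (\<rho> x)" for f L x y z
      using order_trans[OF lipschitz_onD[OF that(1) p(1) that(2)] 
          mult_left_mono[OF near[OF that(3)] lipschitz_on_nonneg[OF that(1)]]] by (simp add: dist_real_def)
    have int: "set_integrable lborel (ball x (\<rho> x)) (\<lambda>z. f (p z))" if "L-lipschitz_on M f" for f :: "'a \<Rightarrow> real" and L x
    proof -
      obtain y where "y \<in> M" using M by auto
      show ?thesis
        by (rule ball_integrable[where g="\<lambda>z. f (p z)" and c="f y"])
          (use p(3) bd[OF that \<open>y \<in> M\<close>] in auto)
    qed
    define E where "E = (\<lambda>f x. ball_avg (\<lambda>z. f (p z)) x (\<rho> x))"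
    have E1: "(K * L)-lipschitz_on UNIV (E f)" if f: "L-lipschitz_on M f" for f L
      unfolding E_def
    proof (rule K(2)[OF p(3) \<rho>l \<rho>0 lipschitz_on_nonneg[OF f]])
      fix z w
      have "\<bar>f (p z) - f (p w)\<bar> \<le> L * dist (p z) (p w)"
        using lipschitz_onD[OF f p(1) p(1)] by (simp add: dist_real_def)
      also have "\<dots> \<le> L * (dist z w + 2 * \<rho> z + 2 * \<rho> w)"
      proof (rule mult_left_mono[OF _ lipschitz_on_nonneg[OF f]])
        show "dist (p z) (p w) \<le> dist z w + 2 * \<rho> z + 2 * \<rho> w"
          using dist_triangle[of "p z" "p w" z] dist_triangle[of z "p w" w] p(2)[of z] p(2)[of w]
          by (simp add: dist_commute)
      qed
      finally show "\<bar>f (p z) - f (p w)\<bar> \<le> L * (dist z w + 2 * \<rho> z + 2 * \<rho> w)" .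
    qed
    have E2: "\<bar>E f x - f x\<bar> \<le> 5 * L * \<epsilon>" if f: "L-lipschitz_on M f" and x: "x \<in> M" for f L x
    proof -
      have "\<rho> x = \<epsilon>" using x \<epsilon> by (simp add: \<rho>_def)
      moreover have "\<bar>E f x - f x\<bar> \<le> L * (dist x x + 5 * \<rho> x)"
        unfolding E_def
        by (rule ball_avg_bound[where g="\<lambda>z. f (p z)"]) (use p(3)[of f] bd[OF f x, of _ x] \<rho>0[of x] in auto)
      ultimately show ?thesis by (simp add: ac_simps)
    qed
    have E3: "E (\<lambda>x. f x + g x) = (\<lambda>x. E f x + E g x)" 
      if "L-lipschitz_on M f" "L'-lipschitz_on M g" for f g L L'
      using int[OF that(1)] int[OF that(2)]
      by (simp add: E_def ball_avg_def set_integral_add add_divide_distrib fun_eq_iff)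
    have E4: "E (\<lambda>x. c * f x) = (\<lambda>x. c * E f x)" for f c
      by (simp add: E_def ball_avg_def fun_eq_iff)
    have "smoothed_extension K M \<epsilon> E"
      unfolding smoothed_extension_def
      by (intro conjI allI impI ballI) (erule E1, erule (1) E2, erule (1) E3, rule E4)
    then show ?thesis by blast
  qed
  show ?thesis by (rule that[OF K(1)]) (rule ex)
qed

text \<open>The approximants share the constant \<open>K\<close>, which the limit inherits, and
  their errors on \<open>M\<close> tend to \<open>0\<close>. Boundedness at an arbitrary point,
  needed for a limit along \<open>U\<close>, comes from comparison with one point of
  \<open>M\<close>.\<close>

theorem lipschitz_extension_operator:
  fixes M :: "'a::euclidean_space set"
  assumes M: "M \<noteq> {}"
  obtains K E where "K \<ge> 0"
    "\<And>f L. L-lipschitz_on M f \<Longrightarrow> (K * L)-lipschitz_on UNIV (E f)"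
    "\<And>f L x. L-lipschitz_on M f \<Longrightarrow> x \<in> M \<Longrightarrow> E f x = (f x :: real)"
    "\<And>f g L L'. L-lipschitz_on M f \<Longrightarrow> L'-lipschitz_on M g \<Longrightarrow> E (\<lambda>x. f x + g x) = (\<lambda>x. E f x + E g x)"
    "\<And>f c L. L-lipschitz_on M f \<Longrightarrow> E (\<lambda>x. c * f x) = (\<lambda>x. c * E f x)"
proof -
  obtain K :: real where K: "K \<ge> 0" and
    ex: "\<And>(M :: 'a::euclidean_space set) \<epsilon>. M \<noteq> {} \<Longrightarrow> \<epsilon> > 0 \<Longrightarrow> 
      \<exists>E. smoothed_extension K M \<epsilon> E"
    by (rule ex_smoothed_extension) blast
  define \<epsilon> where "\<epsilon> = (\<lambda>k. inverse (real (Suc k)))"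
  have \<epsilon>: "\<epsilon> k > 0" "\<epsilon> k \<le> 1" "\<epsilon> \<longlonglongrightarrow> 0" for k
    unfolding \<epsilon>_def using LIMSEQ_inverse_real_of_nat by (auto simp: field_simps)
  have "\<forall>k. \<exists>E. smoothed_extension K M (\<epsilon> k) E"
    using ex[OF M \<epsilon>(1)] by blast
  from choice[OF this] obtain E where E: "\<And>k. smoothed_extension K M (\<epsilon> k) (E k)" by blast
  note E' = E[unfolded smoothed_extension_def]
  have E1: "(K * L)-lipschitz_on UNIV (E k f)" if "L-lipschitz_on M f" for k f L
    using E'[THEN conjunct1, of k] that by simp
  have E2: "\<bar>E k f x - f x\<bar> \<le> 5 * L * \<epsilon> k" if "L-lipschitz_on M f" "x \<in> M" for k f L x
    using E'[THEN conjunct1, of k] that by simp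
  have E3: "E k (\<lambda>x. f x + g x) = (\<lambda>x. E k f x + E k g x)"
    if "L-lipschitz_on M f" "L'-lipschitz_on M g" for k f g L L'
    by (rule E'[THEN conjunct2, THEN conjunct1, rule_format, OF that])
  have E4: "E k (\<lambda>x. c * f x) = (\<lambda>x. c * E k f x)" for k f c
    by (rule E'[THEN conjunct2, THEN conjunct2, rule_format])
  obtain U where U: "U \<le> sequentially" "ultra U" 
    using ex_ultra_le[of "sequentially :: nat filter"] by auto
  have U0: "U \<noteq> bot" using U by (simp add: ultra_def)
  define F where "F = (\<lambda>f x. Lim U (\<lambda>k. E k f x))"
  have lim: "((\<lambda>k. E k f x) \<longlongrightarrow> F f x) U" if f: "L-lipschitz_on M f" for f L x
  proof -
    obtain y where y: "y \<in> M" using M by auto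
    have "\<bar>E k f x\<bar> \<le> K * L * dist x y + 5 * L + \<bar>f y\<bar>" for k
    proof -
      have "\<bar>E k f x - E k f y\<bar> \<le> K * L * dist x y"
        using lipschitz_onD[OF E1[OF f, of k], of x y] by (simp add: dist_real_def)
      moreover have "\<bar>E k f y - f y\<bar> \<le> 5 * L"
        using E2[OF f y, of k] mult_left_mono[OF \<epsilon>(2)[of k], of "5 * L"] lipschitz_on_nonneg[OF f] by simp
      ultimately show ?thesis by linarith
    qed
    then show ?thesis
      unfolding F_def by (intro ultra_bounded_tendsto[OF U(2) always_eventually]) auto
  qed
  show ?thesis
  proof (rule that[OF K])
    fix f :: "'a \<Rightarrow> real" and L assume f: "L-lipschitz_on M f"
    show "(K * L)-lipschitz_on UNIV (F f)"
    proof (rule lipschitz_onI)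
      fix x y
      have "((\<lambda>k. dist (E k f x) (E k f y)) \<longlongrightarrow> dist (F f x) (F f y)) U"
        by (intro tendsto_dist lim[OF f])
      then show "dist (F f x) (F f y) \<le> K * L * dist x y"
        using lipschitz_onD[OF E1[OF f]] by (intro tendsto_upperbound[OF _ _ U0]) auto
    qed (use K lipschitz_on_nonneg[OF f] in auto)
    show "F f x = f x" if x: "x \<in> M" for x
    proof (rule tendsto_unique[OF U0 lim[OF f]])
      have "(\<lambda>k. 5 * L * \<epsilon> k) \<longlonglongrightarrow> 0"
        by (rule tendsto_mult_right_zero[OF \<epsilon>(3)])
      moreover have "\<forall>\<^sub>F k in sequentially. norm (E k f x - f x) \<le> 5 * L * \<epsilon> k"
        using E2[OF f x] by simp
      ultimately have "(\<lambda>k. E k f x - f x) \<longlonglongrightarrow> 0"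
        by (rule Lim_null_comparison[rotated])
      then have "(\<lambda>k. E k f x) \<longlonglongrightarrow> f x" by (simp add: LIM_zero_iff)
      then show "((\<lambda>k. E k f x) \<longlongrightarrow> f x) U" by (rule tendsto_mono[OF U(1)])
    qed
    show "F (\<lambda>x. c * f x) = (\<lambda>x. c * F f x)" for c
    proof
      fix x
      have "((\<lambda>k. E k (\<lambda>x. c * f x) x) \<longlongrightarrow> c * F f x) U"
        unfolding E4[of _ c f] by (intro tendsto_intros lim[OF f])
      then show "F (\<lambda>x. c * f x) x = c * F f x"
        using tendsto_Lim[OF U0] by (metis F_def)
    qed
    fix g :: "'a \<Rightarrow> real" and L' assume g: "L'-lipschitz_on M g"
    show "F (\<lambda>x. f x + g x) = (\<lambda>x. F f x + F g x)"
    proof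
      fix x
      have "((\<lambda>k. E k (\<lambda>x. f x + g x) x) \<longlongrightarrow> F f x + F g x) U"
        unfolding E3[OF f g] by (intro tendsto_intros lim[OF f] lim[OF g])
      then show "F (\<lambda>x. f x + g x) x = F f x + F g x"
        using tendsto_Lim[OF U0] by (metis F_def)
    qed
  qed
qed

subsection \<open>Sets of positive measure\<close>

text \<open>Holes of fixed relative size mean that \<open>M\<close> fills at most the fraction
  \<open>1 - \<theta>\<close> of each ball in a disjoint Vitali cover of \<open>M\<close> inside an
  open \<open>W\<close> slightly larger than \<open>M\<close>. If \<open>W\<close> has measure below
  \<open>1 + \<theta>\<close> times that of \<open>M\<close>, then the measure of \<open>M\<close>
  is at most \<open>1 - \<theta> * \<theta>\<close> times itself.\<close>

lemma porous_imp_null: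
  fixes M :: "'a::euclidean_space set"
  assumes M: "M \<in> lmeasurable" and U: "open U" "M \<subseteq> U" and \<epsilon>: "0 < \<epsilon>" "\<epsilon> \<le> 1"
    and porous: "\<And>x r. r > 0 \<Longrightarrow> ball x r \<subseteq> U \<Longrightarrow> \<exists>y\<in>ball x r. ball y (\<epsilon> * r) \<inter> M = {}"
  shows "measure lebesgue M = 0"
proof (rule ccontr)
  \<comment> \<open>The hole is sought in the concentric ball of half the radius, so that it cannot
    stick out of the ball; hence the 2.\<close>
  define \<theta> where "\<theta> = (\<epsilon> / 2) ^ DIM('a)"
  have \<theta>: "0 < \<theta>" "\<theta> \<le> 1" using \<epsilon> by (auto simp: \<theta>_def intro: power_le_one)
  assume "measure lebesgue M \<noteq> 0"
  then have m: "measure lebesgue M > 0" by (simp add: zero_less_measure_iff)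
  define \<delta> where "\<delta> = \<theta> * measure lebesgue M"
  have \<delta>: "\<delta> > 0" using \<theta> m by (simp add: \<delta>_def)
  obtain T where T: "open T" "M \<subseteq> T" "T - M \<in> lmeasurable" "emeasure lebesgue (T - M) < ennreal \<delta>"
    using sets_lebesgue_outer_open[OF fmeasurableD[OF M] \<delta>] .
  define W where "W = T \<inter> U"
  have W: "open W" "M \<subseteq> W" "W \<subseteq> U" using T U by (auto simp: W_def)
  have "T = M \<union> (T - M)" using T by auto
  then have Tm: "T \<in> lmeasurable" using M T(3) by (metis fmeasurable.Un)
  have Wm: "W \<in> lmeasurable"
    by (rule fmeasurableI2[OF Tm]) (auto simp: W_def T U)
  have "measure lebesgue W \<le> measure lebesgue T"
    by (rule measure_mono_fmeasurable) (auto simp: W_def Tm T U)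
  moreover have "measure lebesgue (T - M) = measure lebesgue T - measure lebesgue M"
    by (rule measurable_measure_Diff[OF Tm fmeasurableD[OF M] T(2)])
  moreover have "measure lebesgue (T - M) < \<delta>"
    using T(4) \<delta> emeasure_eq_measure2[OF T(3)] by (simp add: ennreal_less_iff)
  ultimately have WM: "measure lebesgue W < measure lebesgue M + \<delta>" by linarith

  define K where "K = {(x, r). r > 0 \<and> ball x r \<subseteq> W}"
  have "\<exists>i. i \<in> K \<and> x \<in> ball (fst i) (snd i) \<and> snd i < d" if "x \<in> M" "0 < d" for x d
  proof -
    have "x \<in> W" using W(2) that by blast
    then obtain e where "e > 0" "ball x e \<subseteq> W" by (rule openE[OF W(1)])
    then show ?thesis using that
      by (intro exI[of _ "(x, min e (d / 2))"]) (auto simp: K_def)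
  qed
  then obtain C where C: "countable C" "C \<subseteq> K" "pairwise (\<lambda>i j. disjnt (ball (fst i) (snd i)) (ball (fst j) (snd j))) C"
    "negligible (M - (\<Union>i\<in>C. ball (fst i) (snd i)))"
    using Vitali_covering_theorem_balls[of M K fst snd] by blast
  define B where "B = (\<lambda>i :: 'a \<times> real. ball (fst i) (snd i))"
  have hole: "measure lebesgue (B i \<inter> M) \<le> (1 - \<theta>) * measure lebesgue (B i)" if "i \<in> C" for i
  proof -
    obtain x r where i: "i = (x, r)" by (cases i)
    then have r: "r > 0" "ball x r \<subseteq> U" using that C(2) W by (auto simp: K_def)
    then have "ball x (r / 2) \<subseteq> U" using subset_ball[of "r / 2" r x] by auto
    then obtain y where y: "y \<in> ball x (r / 2)" "ball y (\<epsilon> * (r / 2)) \<inter> M = {}"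
      using porous[of "r / 2" x] r by auto
    have "\<epsilon> * r \<le> r" using \<epsilon> r by simp
    then have sub: "ball y (\<epsilon> * (r / 2)) \<subseteq> ball x r"
      using y(1) by (auto simp: ball_subset_ball_iff dist_commute)
    have "measure lebesgue (B i \<inter> M) \<le> measure lebesgue (ball x r - ball y (\<epsilon> * (r / 2)))"
      using y(2) M by (intro measure_mono_fmeasurable) (auto simp: B_def i fmeasurable.Int)
    also have "\<dots> = measure lebesgue (ball x r) - measure lebesgue (ball y (\<epsilon> * (r / 2)))"
      using sub by (intro measurable_measure_Diff) auto
    also have "measure lebesgue (ball y (\<epsilon> * (r / 2))) = (\<epsilon> / 2 * r) ^ DIM('a) * measure lebesgue (ball (0::'a) 1)"
      using content_ball_conv_unit_ball[of "\<epsilon> * (r / 2)" y] \<epsilon> r by (simp add: ac_simps)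
    also have "\<dots> = \<theta> * measure lebesgue (ball x r)"
      using content_ball_conv_unit_ball[of r x] r by (simp add: \<theta>_def flip: power_mult_distrib)
    finally show ?thesis by (simp add: B_def i algebra_simps)
  qed
  have Bm: "B i \<in> lmeasurable" for i by (simp add: B_def)
  have disj: "disjoint_family_on B C"
    using C(3) by (auto simp: B_def disjoint_family_on_def pairwise_def disjnt_def)
  have BW: "B i \<subseteq> W" if "i \<in> C" for i using that C(2) by (cases i) (auto simp: K_def B_def)
  have mono: "emeasure lebesgue (B i \<inter> M) \<le> ennreal (1 - \<theta>) * emeasure lebesgue (B i)" if "i \<in> C" for i
  proof -
    have "B i \<inter> M \<in> lmeasurable" using M Bm by (simp add: fmeasurable.Int)
    then show ?thesis using hole[OF that] \<theta> Bm[of i]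
      by (simp add: emeasure_eq_measure2 ennreal_mult[symmetric] ennreal_leI)
  qed
  have "emeasure lebesgue M = emeasure lebesgue (\<Union>i\<in>C. B i \<inter> M)"
  proof -
    have "M = (M - (\<Union>i\<in>C. B i)) \<union> (\<Union>i\<in>C. B i \<inter> M)" by auto
    then have "emeasure lebesgue M = emeasure lebesgue ((\<Union>i\<in>C. B i \<inter> M) \<union> (M - (\<Union>i\<in>C. B i)))"
      by (metis Un_commute)
    also have "\<dots> = emeasure lebesgue (\<Union>i\<in>C. B i \<inter> M)"
      using C(1,4) Bm M
      by (intro emeasure_Un_null_set) (auto simp: negligible_iff_null_sets B_def intro!: sets.countable_UN')
    finally show ?thesis .
  qed
  also have "\<dots> = (\<integral>\<^sup>+i. emeasure lebesgue (B i \<inter> M) \<partial>count_space C)"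
  proof (intro emeasure_UN_countable C(1))
    show "disjoint_family_on (\<lambda>i. B i \<inter> M) C" using disj unfolding disjoint_family_on_def by blast
  qed (use Bm M in auto)
  also have "\<dots> \<le> (\<integral>\<^sup>+i. ennreal (1 - \<theta>) * emeasure lebesgue (B i) \<partial>count_space C)"
    using mono by (intro nn_integral_mono) simp
  also have "\<dots> = ennreal (1 - \<theta>) * (\<integral>\<^sup>+i. emeasure lebesgue (B i) \<partial>count_space C)"
    by (rule nn_integral_cmult) simp
  also have "(\<integral>\<^sup>+i. emeasure lebesgue (B i) \<partial>count_space C) = emeasure lebesgue (\<Union>i\<in>C. B i)"
    using Bm disj by (intro emeasure_UN_countable[symmetric] C(1)) auto
  also have "\<dots> \<le> emeasure lebesgue W"
    using BW Wm by (intro emeasure_mono) auto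
  finally have "emeasure lebesgue M \<le> ennreal (1 - \<theta>) * emeasure lebesgue W"
    by (simp add: mult_left_mono)
  then have "measure lebesgue M \<le> (1 - \<theta>) * measure lebesgue W"
    using M Wm \<theta> by (simp add: emeasure_eq_measure2 ennreal_mult[symmetric])
  also have "\<dots> \<le> (1 - \<theta>) * (measure lebesgue M + \<delta>)"
    using WM \<theta> by (intro mult_left_mono) auto
  also have "\<dots> = measure lebesgue M - \<theta> * \<theta> * measure lebesgue M"
    by (simp add: \<delta>_def algebra_simps)
  finally have "\<theta> * \<theta> * measure lebesgue M \<le> 0" by simp
  moreover have "\<theta> * \<theta> * measure lebesgue M > 0" using \<theta> m by simp
  ultimately show False by linarith
qed

text \<open>Contrapositive of \<open>porous_imp_null\<close>, applied to a bounded part of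
  \<open>M \<inter> U\<close> to have finite measure: a ball that violates porosity has no point far
  from \<open>M\<close>. Taking \<open>min \<epsilon> 1\<close> meets the bound on the hole size
  there.\<close>

lemma ex_epsilon_dense_ball:
  fixes M :: "'a::euclidean_space set"
  assumes M: "M \<in> sets lebesgue" and U: "open U" and pos: "emeasure lebesgue (M \<inter> U) > 0" and \<epsilon>: "0 < \<epsilon>"
  obtains c r where "r > 0" "ball c r \<subseteq> U" "\<And>y. y \<in> ball c r \<Longrightarrow> \<exists>q\<in>M. dist q y < \<epsilon> * r"
proof -
  define V where "V = (\<lambda>n::nat. U \<inter> ball 0 (real n))"
  have UN: "M \<inter> U = (\<Union>n. M \<inter> V n)"
    unfolding V_def by (auto simp: reals_Archimedean2)
  have MV: "M \<inter> V n \<in> sets lebesgue" for n using M U by (auto simp: V_def)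
  have "\<exists>n. emeasure lebesgue (M \<inter> V n) \<noteq> 0"
  proof (rule ccontr)
    assume "\<not> ?thesis"
    then have "(\<Union>n. M \<inter> V n) \<in> null_sets lebesgue"
      using MV by (intro null_sets_UN) auto
    then show False using pos UN by auto
  qed
  then obtain n where n: "emeasure lebesgue (M \<inter> V n) \<noteq> 0" by blast
  have MVl: "M \<inter> V n \<in> lmeasurable"
    by (rule fmeasurableI2[of "ball 0 (real n)"]) (use MV in \<open>auto simp: V_def\<close>)
  have "measure lebesgue (M \<inter> V n) \<noteq> 0"
    using n MVl by (simp add: emeasure_eq_measure2)
  have "\<not> (\<forall>x r. r > 0 \<longrightarrow> ball x r \<subseteq> V n \<longrightarrow> (\<exists>y\<in>ball x r. ball y (min \<epsilon> 1 * r) \<inter> (M \<inter> V n) = {}))"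
  proof
    assume H: "\<forall>x r. r > 0 \<longrightarrow> ball x r \<subseteq> V n \<longrightarrow> (\<exists>y\<in>ball x r. ball y (min \<epsilon> 1 * r) \<inter> (M \<inter> V n) = {})"
    have "measure lebesgue (M \<inter> V n) = 0"
    proof (rule porous_imp_null[OF MVl, where \<epsilon>="min \<epsilon> 1"])
      show "open (V n)" using U by (simp add: V_def open_Int)
    qed (use \<epsilon> H in auto)
    then show False using \<open>measure lebesgue (M \<inter> V n) \<noteq> 0\<close> by contradiction
  qed
  then obtain x r where r: "r > 0" "ball x r \<subseteq> V n" 
    and d: "\<And>y. y \<in> ball x r \<Longrightarrow> ball y (min \<epsilon> 1 * r) \<inter> (M \<inter> V n) \<noteq> {}" by auto
  show ?thesis
  proof (rule that[OF r(1)])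
    show "ball x r \<subseteq> U" using r by (auto simp: V_def)
    fix y assume "y \<in> ball x r"
    then obtain q where "q \<in> M" "dist y q < min \<epsilon> 1 * r" using d by fastforce
    moreover have "min \<epsilon> 1 * r \<le> \<epsilon> * r" using r by (intro mult_right_mono) auto
    ultimately show "\<exists>q\<in>M. dist q y < \<epsilon> * r" by (auto simp: dist_commute intro!: bexI[of _ q])
  qed
qed

text \<open>By Lindelof some point \<open>w\<close> has no neighbourhood that meets \<open>M\<close>
  in a null set. Disjoint annuli around \<open>w\<close> serve: as \<open>{w}\<close> is null,
  removing a small enough closed ball from any ball about \<open>w\<close> still leaves positive
  measure.\<close>

lemma ex_disjoint_open_positive:
  fixes M :: "'a::euclidean_space set"
  assumes M: "M \<in> sets lebesgue" and pos: "emeasure lebesgue M > 0"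
  obtains U :: "nat \<Rightarrow> 'a set" where "\<And>m. open (U m)" "disjoint_family U" 
    "\<And>m. emeasure lebesgue (M \<inter> U m) > 0"
proof -
  have "\<exists>w. \<forall>r>0. emeasure lebesgue (M \<inter> ball w r) > 0"
  proof (rule ccontr)
    assume "\<not> ?thesis"
    then obtain r where r: "\<And>w. r w > 0" "\<And>w. emeasure lebesgue (M \<inter> ball w (r w)) = 0"
      by (auto simp: zero_less_iff_neq_zero) metis
    obtain F where F: "F \<subseteq> range (\<lambda>w. ball w (r w))" "countable F" "\<Union>F = \<Union>(range (\<lambda>w. ball w (r w)))"
      by (rule Lindelof[of "range (\<lambda>w. ball w (r w))"]) auto
    have "\<Union>F = UNIV" unfolding F using r(1) by (auto intro!: centre_in_ball[THEN iffD2])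
    then have "M = (\<Union>B\<in>F. M \<inter> B)" by auto
    moreover have "(\<Union>B\<in>F. M \<inter> B) \<in> null_sets lebesgue"
    proof (rule null_sets_UN'[OF F(2)])
      fix B assume "B \<in> F"
      then obtain w where "B = ball w (r w)" using F by auto
      then show "M \<inter> B \<in> null_sets lebesgue" using r(2)[of w] M by (auto simp: null_sets_def)
    qed
    ultimately show False using pos by auto
  qed
  then obtain w where w: "\<And>r. r > 0 \<Longrightarrow> emeasure lebesgue (M \<inter> ball w r) > 0" by blast
  have step: "\<exists>s. 0 < s \<and> s < r \<and> emeasure lebesgue (M \<inter> (ball w r - cball w s)) > 0" if "r > 0" for r
  proof (rule ccontr)
    assume "\<not> ?thesis"
    then have z: "emeasure lebesgue (M \<inter> (ball w r - cball w s)) = 0" if "0 < s" "s < r" for s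
      using that by (auto simp: zero_less_iff_neq_zero)
    have sub: "M \<inter> ball w r \<subseteq> {w} \<union> (\<Union>n::nat. M \<inter> (ball w r - cball w (r / (real n + 2))))"
    proof
      fix x assume x: "x \<in> M \<inter> ball w r"
      show "x \<in> {w} \<union> (\<Union>n::nat. M \<inter> (ball w r - cball w (r / (real n + 2))))"
      proof (cases "x = w")
        case False
        then have d: "dist w x > 0" by simp
        obtain n :: nat where "r / dist w x < real n" using reals_Archimedean2 by blast
        then have "r < real n * dist w x" using d by (simp add: field_simps)
        also have "\<dots> \<le> (real n + 2) * dist w x" using d by (intro mult_right_mono) auto
        finally have "r / (real n + 2) < dist w x" by (simp add: field_simps)
        then show ?thesis using x by (intro UnI2 UN_I[of n]) auto
      qed auto
    qed
    have "{w} \<union> (\<Union>n::nat. M \<inter> (ball w r - cball w (r / (real n + 2)))) \<in> null_sets lebesgue"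
    proof (intro null_sets.Un null_sets_UN)
      show "{w} \<in> null_sets lebesgue" by (simp flip: negligible_iff_null_sets)
      fix n :: nat
      have "emeasure lebesgue (M \<inter> (ball w r - cball w (r / (real n + 2)))) = 0"
        using that by (intro z) (auto simp: field_simps add_pos_nonneg)
      then show "M \<inter> (ball w r - cball w (r / (real n + 2))) \<in> null_sets lebesgue"
        using M by (auto simp: null_sets_def)
    qed
    then have "M \<inter> ball w r \<in> null_sets lebesgue"
      by (rule null_sets_subset) (use M sub in auto)
    then show False using w[OF that] by auto
  qed
  have "\<exists>\<rho>::nat \<Rightarrow> real. \<forall>m. 0 < \<rho> m \<and> (0 < \<rho> (Suc m) \<and> \<rho> (Suc m) < \<rho> m \<and> 
     emeasure lebesgue (M \<inter> (ball w (\<rho> m) - cball w (\<rho> (Suc m)))) > 0)"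
    by (rule dependent_nat_choice[of "\<lambda>_ r. 0 < r" "\<lambda>_ r s. 0 < s \<and> s < r \<and> emeasure lebesgue (M \<inter> (ball w r - cball w s)) > 0"])
      (use step in \<open>auto intro: exI[of _ "1::real"]\<close>)
  then obtain \<rho> :: "nat \<Rightarrow> real" where \<rho>: "\<And>m. 0 < \<rho> m" "\<And>m. \<rho> (Suc m) < \<rho> m"
     "\<And>m. emeasure lebesgue (M \<inter> (ball w (\<rho> m) - cball w (\<rho> (Suc m)))) > 0" by blast
  have dec: "\<rho> n \<le> \<rho> m" if "m \<le> n" for m n
    using that by (rule lift_Suc_antimono_le[rotated]) (use \<rho>(2) in \<open>auto intro: less_imp_le\<close>)
  show ?thesis
  proof (rule that[of "\<lambda>m. ball w (\<rho> m) - cball w (\<rho> (Suc m))"])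
    have "(ball w (\<rho> m) - cball w (\<rho> (Suc m))) \<inter> (ball w (\<rho> n) - cball w (\<rho> (Suc n))) = {}" if "m < n" for m n
      using dec[of "Suc m" n] that by auto
    then show "disjoint_family (\<lambda>m. ball w (\<rho> m) - cball w (\<rho> (Suc m)))"
      unfolding disjoint_family_on_def by (metis Int_commute nat_neq_iff)
  qed (use \<rho> in auto)
qed

text \<open>Plays the role of a Lebesgue density point: the set looks like the whole space
  in infinitely many disjoint balls, at ever finer relative scales.\<close>

lemma ex_disjoint_dense_balls:
  fixes M :: "'a::euclidean_space set" and \<epsilon> :: "nat \<Rightarrow> real"
  assumes M: "M \<in> sets lebesgue" and pos: "emeasure lebesgue M > 0" and \<epsilon>: "\<And>m. \<epsilon> m > 0"
  obtains c r where "\<And>m. r m > 0" "disjoint_family (\<lambda>m. ball (c m) (r m))"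
    "\<And>m y. y \<in> ball (c m) (r m) \<Longrightarrow> \<exists>q\<in>M. dist q y < \<epsilon> m * r m"
proof -
  obtain U :: "nat \<Rightarrow> 'a set" where U: "\<And>m. open (U m)" "disjoint_family U"
    "\<And>m. emeasure lebesgue (M \<inter> U m) > 0"
    by (rule ex_disjoint_open_positive[OF M pos]) blast
  have "\<exists>c r. r > 0 \<and> ball c r \<subseteq> U m \<and> (\<forall>y\<in>ball c r. \<exists>q\<in>M. dist q y < \<epsilon> m * r)" for m
    by (rule ex_epsilon_dense_ball[OF M U(1)[of m] U(3)[of m] \<epsilon>[of m]]) blast
  then have "\<exists>c. \<forall>m. \<exists>r. r > 0 \<and> ball (c m) r \<subseteq> U m \<and> (\<forall>y\<in>ball (c m) r. \<exists>q\<in>M. dist q y < \<epsilon> m * r)"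
    by (intro choice allI)
  then obtain c where
    "\<forall>m. \<exists>r. r > 0 \<and> ball (c m) r \<subseteq> U m \<and> (\<forall>y\<in>ball (c m) r. \<exists>q\<in>M. dist q y < \<epsilon> m * r)" ..
  from choice[OF this] obtain r where
    cr: "\<forall>m. r m > 0 \<and> ball (c m) (r m) \<subseteq> U m \<and> (\<forall>y\<in>ball (c m) (r m). \<exists>q\<in>M. dist q y < \<epsilon> m * r m)" ..
  then have "disjoint_family (\<lambda>m. ball (c m) (r m))"
    by (intro disjoint_family_subset[OF U(2)]) blast
  then show ?thesis
    using cr by (intro that[of r c]) blast+
qed

subsection \<open>The decomposition method\<close>

locale normed_function_space =
  fixes V :: "('a \<Rightarrow> real) set" and N :: "('a \<Rightarrow> real) \<Rightarrow> real"
  assumes zero_mem: "0 \<in> V"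
    and add_mem: "f \<in> V \<Longrightarrow> g \<in> V \<Longrightarrow> f + g \<in> V"
    and scale_mem: "f \<in> V \<Longrightarrow> (\<lambda>x. c * f x) \<in> V"
    and norm_nonneg: "f \<in> V \<Longrightarrow> 0 \<le> N f"
    and norm_add: "f \<in> V \<Longrightarrow> g \<in> V \<Longrightarrow> N (f + g) \<le> N f + N g"
    and norm_scale: "f \<in> V \<Longrightarrow> N (\<lambda>x. c * f x) \<le> \<bar>c\<bar> * N f"
begin

lemma diff_eq: "f - g = f + (\<lambda>x. (-1) * g x)" for f g :: "'a \<Rightarrow> real"
  by (auto simp: fun_eq_iff)

lemma diff_mem: "f \<in> V \<Longrightarrow> g \<in> V \<Longrightarrow> f - g \<in> V"
  unfolding diff_eq by (intro add_mem scale_mem)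

lemma norm_diff: "f \<in> V \<Longrightarrow> g \<in> V \<Longrightarrow> N (f - g) \<le> N f + N g"
  unfolding diff_eq using norm_add[OF _ scale_mem[where c="-1"], of f g] norm_scale[of g "-1"] by simp

end

lemma blm_mem: "bounded_linear_map V N W K T \<Longrightarrow> f \<in> V \<Longrightarrow> T f \<in> W"
  by (simp add: bounded_linear_map_def)

lemma blm_add:
  "bounded_linear_map V N W K T \<Longrightarrow> f \<in> V \<Longrightarrow> g \<in> V \<Longrightarrow> T (f + g) = T f + T g"
  by (simp add: bounded_linear_map_def plus_fun_def)

lemma blm_scale:
  "bounded_linear_map V N W K T \<Longrightarrow> f \<in> V \<Longrightarrow> T (\<lambda>x. c * f x) = (\<lambda>y. c * T f y)"
  by (simp add: bounded_linear_map_def)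

lemma blm_diff:
  assumes "normed_function_space V N" "bounded_linear_map V N W K T" "f \<in> V" "g \<in> V"
  shows "T (f - g) = T f - T g"
proof -
  interpret normed_function_space V N by fact
  have "T (f - g) = T f + (\<lambda>x. (-1) * T g x)"
    unfolding diff_eq using assms by (simp only: blm_add[OF assms(2)] blm_scale[OF assms(2)] scale_mem)
  then show ?thesis by (simp add: fun_eq_iff)
qed

lemma blm_bound:
  assumes "normed_function_space V N" "bounded_linear_map V N W K T"
  obtains C where "C \<ge> 0" "\<And>f. f \<in> V \<Longrightarrow> K (T f) \<le> C * N f"
proof -
  interpret normed_function_space V N by fact
  from assms(2) obtain C where C: "\<And>f. f \<in> V \<Longrightarrow> K (T f) \<le> C * N f"
    unfolding bounded_linear_map_def by blast
  have "K (T f) \<le> max C 0 * N f" if "f \<in> V" for f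
    using C[OF that] mult_right_mono[OF max.cobounded1[of C 0] norm_nonneg[OF that]] by linarith
  then show ?thesis by (intro that[of "max C 0"]) auto
qed

lemma blmI:
  assumes "\<And>f. f \<in> V \<Longrightarrow> T f \<in> W"
    and "\<And>f g. f \<in> V \<Longrightarrow> g \<in> V \<Longrightarrow> T (f + g) = T f + T g"
    and "\<And>c f. f \<in> V \<Longrightarrow> T (\<lambda>x. c * f x) = (\<lambda>y. c * T f y)"
    and "\<And>f. f \<in> V \<Longrightarrow> K (T f) \<le> C * N f"
  shows "bounded_linear_map V N W K T"
  using assms unfolding bounded_linear_map_def plus_fun_def by blast

lemma blm_compose:
  assumes "normed_function_space V N" "normed_function_space W K"
    and T: "bounded_linear_map V N W K T" and S: "bounded_linear_map W K U L S"
  shows "bounded_linear_map V N U L (\<lambda>f. S (T f))"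
proof -
  obtain C where C: "C \<ge> 0" "\<And>f. f \<in> V \<Longrightarrow> K (T f) \<le> C * N f"
    using blm_bound[OF assms(1) T] by blast
  obtain D where D: "D \<ge> 0" "\<And>f. f \<in> W \<Longrightarrow> L (S f) \<le> D * K f"
    using blm_bound[OF assms(2) S] by blast
  show ?thesis
  proof (rule blmI[where C="D * C"])
    fix f assume f: "f \<in> V"
    have "L (S (T f)) \<le> D * K (T f)" using D(2) blm_mem[OF T f] .
    also have "\<dots> \<le> D * (C * N f)" using C(2)[OF f] D(1) by (rule mult_left_mono)
    finally show "L (S (T f)) \<le> D * C * N f" by simp
  qed (simp_all add: blm_mem[OF T] blm_mem[OF S] blm_add[OF T] blm_add[OF S] blm_scale[OF T] blm_scale[OF S])
qed

lemma blm_plus: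
  assumes "normed_function_space V N" "normed_function_space W K"
    and T: "bounded_linear_map V N W K T" and S: "bounded_linear_map V N W K S"
  shows "bounded_linear_map V N W K (\<lambda>f. T f + S f)"
proof -
  obtain C where C: "C \<ge> 0" "\<And>f. f \<in> V \<Longrightarrow> K (T f) \<le> C * N f"
    using blm_bound[OF assms(1) T] by blast
  obtain D where D: "D \<ge> 0" "\<And>f. f \<in> V \<Longrightarrow> K (S f) \<le> D * N f"
    using blm_bound[OF assms(1) S] by blast
  interpret W: normed_function_space W K by fact
  show ?thesis
  proof (rule blmI[where C="C + D"])
    fix f assume f: "f \<in> V"
    show "K (T f + S f) \<le> (C + D) * N f"
      using W.norm_add[OF blm_mem[OF T f] blm_mem[OF S f]] C(2)[OF f] D(2)[OF f]
      by (simp add: algebra_simps)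
  qed (simp_all add: blm_mem[OF T] blm_mem[OF S] blm_add[OF T] blm_add[OF S] blm_scale[OF T] 
        blm_scale[OF S] W.add_mem fun_eq_iff algebra_simps)
qed

lemma blm_minus:
  assumes "normed_function_space V N" "normed_function_space W K"
    and T: "bounded_linear_map V N W K T" and S: "bounded_linear_map V N W K S"
  shows "bounded_linear_map V N W K (\<lambda>f. T f - S f)"
proof -
  obtain C where C: "C \<ge> 0" "\<And>f. f \<in> V \<Longrightarrow> K (T f) \<le> C * N f"
    using blm_bound[OF assms(1) T] by blast
  obtain D where D: "D \<ge> 0" "\<And>f. f \<in> V \<Longrightarrow> K (S f) \<le> D * N f"
    using blm_bound[OF assms(1) S] by blast
  interpret W: normed_function_space W K by fact
  show ?thesis
  proof (rule blmI[where C="C + D"])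
    fix f assume f: "f \<in> V"
    show "K (T f - S f) \<le> (C + D) * N f"
      using W.norm_diff[OF blm_mem[OF T f] blm_mem[OF S f]] C(2)[OF f] D(2)[OF f]
      by (simp add: algebra_simps)
  qed (simp_all add: blm_mem[OF T] blm_mem[OF S] blm_add[OF T] blm_add[OF S] blm_scale[OF T] 
        blm_scale[OF S] W.diff_mem fun_eq_iff algebra_simps)
qed

lemma blm_id: "bounded_linear_map V N V N (\<lambda>f. f)"
  by (rule blmI[where C=1]) auto

text \<open>\<open>inv_into V T\<close> is determined only on \<open>W\<close>, where it equals
  \<open>S\<close>; closure of \<open>W\<close> under the operations carries the laws of
  \<open>S\<close> over to it.\<close>

lemma linearly_isomorphicI:
  assumes V: "normed_function_space V N" and W: "normed_function_space W K"
    and T: "bounded_linear_map V N W K T" and S: "bounded_linear_map W K V N S"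
    and ST: "\<And>f. f \<in> V \<Longrightarrow> S (T f) = f" and TS: "\<And>g. g \<in> W \<Longrightarrow> T (S g) = g"
  shows "linearly_isomorphic V N W K"
proof -
  interpret W: normed_function_space W K by fact
  have bij: "bij_betw T V W"
    by (rule bij_betwI[where g=S]) (auto simp: blm_mem[OF T] blm_mem[OF S] ST TS)
  have inv: "inv_into V T g = S g" if "g \<in> W" for g
    using that by (intro inv_into_f_eq) (auto simp: blm_mem[OF S] TS bij_betw_imp_inj_on[OF bij])
  obtain C where C: "\<And>f. f \<in> W \<Longrightarrow> N (S f) \<le> C * K f"
    using blm_bound[OF W S] by blast
  have "bounded_linear_map W K V N (inv_into V T)"
    by (rule blmI[where C=C])
      (simp_all add: inv W.add_mem W.scale_mem blm_mem[OF S] blm_add[OF S] blm_scale[OF S] C)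
  then show ?thesis unfolding linearly_isomorphic_def using bij T by blast
qed

lemma linearly_isomorphicE:
  assumes "linearly_isomorphic V N W K"
  obtains T S where "bounded_linear_map V N W K T" "bounded_linear_map W K V N S"
    "\<And>f. f \<in> V \<Longrightarrow> S (T f) = f" "\<And>g. g \<in> W \<Longrightarrow> T (S g) = g"
  using assms unfolding linearly_isomorphic_def bij_betw_def
  by (metis f_inv_into_f inv_into_f_f)

lemma linearly_isomorphic_cancel:
  assumes V: "normed_function_space V N" and W: "normed_function_space W K"
    and U: "normed_function_space U L"
    and "linearly_isomorphic V N U L" "linearly_isomorphic W K U L"
  shows "linearly_isomorphic V N W K"
proof -
  obtain T S where TS: "bounded_linear_map V N U L T" "bounded_linear_map U L V N S"
    "\<And>f. f \<in> V \<Longrightarrow> S (T f) = f" "\<And>g. g \<in> U \<Longrightarrow> T (S g) = g"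
    using linearly_isomorphicE[OF assms(4)] by blast
  obtain T' S' where TS': "bounded_linear_map W K U L T'" "bounded_linear_map U L W K S'"
    "\<And>f. f \<in> W \<Longrightarrow> S' (T' f) = f" "\<And>g. g \<in> U \<Longrightarrow> T' (S' g) = g"
    using linearly_isomorphicE[OF assms(5)] by blast
  show ?thesis
    by (rule linearly_isomorphicI[OF V W blm_compose[OF V U TS(1) TS'(2)] blm_compose[OF W U TS'(1) TS(2)]])
      (simp_all add: TS(3,4) TS'(3,4) blm_mem[OF TS(1)] blm_mem[OF TS'(1)])
qed

section \<open>Bounded sequences in a function space\<close>

text \<open>Encoding a sequence of functions on \<open>'a\<close> as one function on
  \<open>nat \<times> 'a\<close> makes the sum again a space of real functions, as
  \<open>linearly_isomorphic\<close> requires.\<close>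

definition linf :: "('a \<Rightarrow> real) set \<Rightarrow> (('a \<Rightarrow> real) \<Rightarrow> real) \<Rightarrow> (nat \<times> 'a \<Rightarrow> real) set" where
  "linf V N = {F. (\<forall>j. curry F j \<in> V) \<and> bdd_above (range (\<lambda>j. N (curry F j)))}"

definition linf_norm :: "(('a \<Rightarrow> real) \<Rightarrow> real) \<Rightarrow> (nat \<times> 'a \<Rightarrow> real) \<Rightarrow> real" where
  "linf_norm N F = (SUP j. N (curry F j))"

lemma linf_component: "F \<in> linf V N \<Longrightarrow> curry F j \<in> V"
  by (simp add: linf_def)

lemma linf_norm_upper: "F \<in> linf V N \<Longrightarrow> N (curry F j) \<le> linf_norm N F"
  unfolding linf_norm_def by (rule cSUP_upper) (auto simp: linf_def)

lemma linf_norm_least: "(\<And>j. N (curry F j) \<le> c) \<Longrightarrow> linf_norm N F \<le> c"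
  unfolding linf_norm_def by (rule cSUP_least) auto

lemma linfI: "(\<And>j. curry F j \<in> V) \<Longrightarrow> (\<And>j. N (curry F j) \<le> c) \<Longrightarrow> F \<in> linf V N"
  unfolding linf_def by (auto simp: bdd_above_def)

lemma linf_eqI: "(\<And>j. curry F j = curry G j) \<Longrightarrow> F = G"
  by (metis curry_case_prod ext case_prod_curry)

lemma curry_add: "curry (F + G) j = curry F j + curry G j"
  and curry_diff: "curry (F - G) j = curry F j - curry G j"
  and curry_scale: "curry (\<lambda>p. c * H p) j = (\<lambda>x. c * curry H j x)"
  for F G :: "nat \<times> 'a \<Rightarrow> real"
  by (auto simp: fun_eq_iff)

lemma linf_normed_function_space:
  assumes "normed_function_space V N"
  shows "normed_function_space (linf V N) (linf_norm N)"
proof -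
  interpret normed_function_space V N by fact
  have c0: "curry 0 j = (0 :: 'a \<Rightarrow> real)" for j :: nat by (auto simp: fun_eq_iff)
  show ?thesis
  proof
    show "0 \<in> linf V N"
      by (rule linfI[where c="N 0"]) (simp_all add: c0 zero_mem)
  next
    fix f g assume fg: "f \<in> linf V N" "g \<in> linf V N"
    have *: "N (curry (f + g) j) \<le> linf_norm N f + linf_norm N g" for j
      unfolding curry_add
      using norm_add[OF fg[THEN linf_component], of j j] fg[THEN linf_norm_upper, of j] by linarith
    show "f + g \<in> linf V N"
      using fg by (intro linfI[where N=N, OF _ *]) (simp add: curry_add add_mem linf_component)
    show "linf_norm N (f + g) \<le> linf_norm N f + linf_norm N g"
      by (rule linf_norm_least) (rule *)
  next
    fix f c assume f: "f \<in> linf V N"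
    have *: "N (curry (\<lambda>p. c * f p) j) \<le> \<bar>c\<bar> * linf_norm N f" for j
      unfolding curry_scale
      using norm_scale[OF f[THEN linf_component], of c j] 
        mult_left_mono[OF f[THEN linf_norm_upper, of j], of "\<bar>c\<bar>"] by linarith
    show "(\<lambda>p. c * f p) \<in> linf V N"
      using f by (intro linfI[where N=N, OF _ *]) (simp only: curry_scale scale_mem linf_component)
    show "linf_norm N (\<lambda>p. c * f p) \<le> \<bar>c\<bar> * linf_norm N f"
      by (rule linf_norm_least) (rule *)
  next
    fix f assume f: "f \<in> linf V N"
    show "0 \<le> linf_norm N f"
      using norm_nonneg[OF linf_component[OF f]] linf_norm_upper[OF f] order_trans by blast
  qed
qed

lemma blm_component:
  shows "bounded_linear_map (linf V N) (linf_norm N) V N (\<lambda>F. curry F j)"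
  by (rule blmI[where C=1]) (auto simp: linf_component linf_norm_upper fun_eq_iff)

definition linf_lift :: "(('a \<Rightarrow> real) \<Rightarrow> ('b \<Rightarrow> real)) \<Rightarrow> (nat \<times> 'a \<Rightarrow> real) \<Rightarrow> (nat \<times> 'b \<Rightarrow> real)" where
  "linf_lift R F = (\<lambda>(j, x). R (curry F j) x)"

lemma curry_linf_lift: "curry (linf_lift R F) j = R (curry F j)"
  by (simp add: linf_lift_def fun_eq_iff)

lemma blm_linf_lift:
  assumes V: "normed_function_space V N" and R: "bounded_linear_map V N W K R"
  shows "bounded_linear_map (linf V N) (linf_norm N) (linf W K) (linf_norm K) (linf_lift R)"
proof -
  obtain C where C: "C \<ge> 0" "\<And>f. f \<in> V \<Longrightarrow> K (R f) \<le> C * N f"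
    using blm_bound[OF V R] by blast
  have *: "K (curry (linf_lift R F) j) \<le> C * linf_norm N F" if F: "F \<in> linf V N" for F j
    unfolding curry_linf_lift using C(2)[OF linf_component[OF F, of j]] 
      mult_left_mono[OF linf_norm_upper[OF F, of j] C(1)] by linarith
  show ?thesis
  proof (rule blmI[where C=C])
    fix F assume F: "F \<in> linf V N"
    show "linf_lift R F \<in> linf W K"
      using linf_component[OF F] by (intro linfI[where N=K, OF _ *[OF F]]) (simp add: curry_linf_lift blm_mem[OF R])
    show "linf_norm K (linf_lift R F) \<le> C * linf_norm N F"
      by (rule linf_norm_least) (rule *[OF F])
    show "linf_lift R (\<lambda>p. c * F p) = (\<lambda>p. c * linf_lift R F p)" for c
      using linf_component[OF F]
      by (intro linf_eqI) (simp only: curry_linf_lift curry_scale blm_scale[OF R])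
    fix G assume G: "G \<in> linf V N"
    show "linf_lift R (F + G) = linf_lift R F + linf_lift R G"
      using linf_component[OF F] linf_component[OF G]
      by (intro linf_eqI) (simp only: curry_linf_lift curry_add blm_add[OF R])
  qed
qed

text \<open>Shifts, selection of the even or odd terms, interleaving and insertion at a single place
  all have this form, so their boundedness is settled once.\<close>

definition reindex :: "(nat \<Rightarrow> nat option) \<Rightarrow> (nat \<times> 'a \<Rightarrow> real) \<Rightarrow> (nat \<times> 'a \<Rightarrow> real)" where
  "reindex \<pi> F = (\<lambda>(i, x). case \<pi> i of None \<Rightarrow> 0 | Some j \<Rightarrow> F (j, x))"

lemma curry_reindex: "curry (reindex \<pi> F) i = (case \<pi> i of None \<Rightarrow> 0 | Some j \<Rightarrow> curry F j)"
  by (auto simp: reindex_def fun_eq_iff split: option.split)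

lemma blm_reindex:
  assumes V: "normed_function_space V N"
  shows "bounded_linear_map (linf V N) (linf_norm N) (linf V N) (linf_norm N) (reindex \<pi>)"
proof -
  interpret normed_function_space V N by fact
  interpret L: normed_function_space "linf V N" "linf_norm N" by (rule linf_normed_function_space[OF V])
  have N0: "N 0 \<le> 0" using norm_scale[OF zero_mem, of 0] by (simp add: zero_fun_def)
  have *: "N (curry (reindex \<pi> F) j) \<le> 1 * linf_norm N F" if F: "F \<in> linf V N" for F j
    using N0 L.norm_nonneg[OF F] linf_norm_upper[OF F]
    by (auto simp: curry_reindex split: option.split)
  show ?thesis
  proof (rule blmI[where C=1])
    fix F assume F: "F \<in> linf V N"
    show "reindex \<pi> F \<in> linf V N"
      using linf_component[OF F]
      by (intro linfI[where N=N, OF _ *[OF F]]) (simp add: curry_reindex zero_mem split: option.split)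
    show "linf_norm N (reindex \<pi> F) \<le> 1 * linf_norm N F"
      by (rule linf_norm_least) (rule *[OF F])
  qed (auto simp: reindex_def fun_eq_iff split: option.split)
qed

lemma blm_diagonal:
  assumes V: "normed_function_space V N"
  shows "bounded_linear_map V N (linf V N) (linf_norm N) (\<lambda>f (j, x). f x)"
  by (rule blmI[where C=1])
    (auto simp: fun_eq_iff curry_def intro!: linfI linf_norm_least)

text \<open>The chain is Y ~ Y + Z ~ Z. For the first step, the copy of Z inside Y is split into
  even and odd terms. For the second, each term of Z is split into its part in the range of
  \<open>A\<close> and a complementary part, and the former parts are shifted by one place to admit
  one more element of Y. \<open>T\<close> is the composite and \<open>S\<close> its inverse, given
  by formulas that avoid forming direct sums.\<close>

theorem pelczynski_decomposition:
  fixes X :: "('b \<Rightarrow> real) set" and Y :: "('a \<Rightarrow> real) set"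
  assumes Y: "normed_function_space Y N" and X: "normed_function_space X P"
    and A: "bounded_linear_map Y N X P A" and B: "bounded_linear_map X P Y N B"
    and BA: "\<And>y. y \<in> Y \<Longrightarrow> B (A y) = y"
    and C: "bounded_linear_map (linf X P) (linf_norm P) Y N C"
    and D: "bounded_linear_map Y N (linf X P) (linf_norm P) D"
    and DC: "\<And>z. z \<in> linf X P \<Longrightarrow> D (C z) = z"
  shows "linearly_isomorphic Y N (linf X P) (linf_norm P)"
proof -
  define Z where "Z = linf X P"
  define NZ where "NZ = linf_norm P"
  have Z: "normed_function_space Z NZ" 
    unfolding Z_def NZ_def by (rule linf_normed_function_space[OF X])
  interpret Y: normed_function_space Y N by fact
  interpret X: normed_function_space X P by fact
  interpret Z: normed_function_space Z NZ by fact
  note C = C[folded Z_def NZ_def] and D = D[folded Z_def NZ_def] and DC = DC[folded Z_def]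
  define evens where "evens = reindex (\<lambda>i. Some (2 * i)) \<circ> D"
  define odds where "odds = reindex (\<lambda>i. Some (2 * i + 1)) \<circ> D"
  \<comment> \<open>Termwise projection of \<open>X\<close> onto the range of
    \<open>A\<close>.\<close>
  define Q where "Q = linf_lift (\<lambda>f. A (B f))"
  \<comment> \<open>Keeps the part of \<open>y\<close> complementary to the range of
    \<open>C\<close> and replaces its sequence \<open>D y\<close> by the even terms; paired with
    \<open>odds y\<close> it loses nothing.\<close>
  define y1 where "y1 = (\<lambda>y. y - C (D y) + C (evens y))"
  define hd where "hd = (\<lambda>f. reindex (\<lambda>i. if i = 0 then Some 0 else None) (\<lambda>(j, x :: 'b). f x))"
  \<comment> \<open>The parts in the range of \<open>A\<close> move up one place, freeing place
    \<open>0\<close> for \<open>A (y1 y)\<close>; the complementary parts stay where they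
    are.\<close>
  define T where "T = (\<lambda>y. hd (A (y1 y)) 
     + (reindex (\<lambda>i. if i = 0 then None else Some (i - 1)) (Q (odds y)) + (odds y - Q (odds y))))"
  \<comment> \<open>\<open>z1\<close> reads the even terms off place \<open>0\<close>, and
    \<open>z2\<close> recovers the odd terms by moving the range parts back down;
    \<open>merge\<close> interleaves the two.\<close>
  define z1 where "z1 = (\<lambda>u :: nat \<times> 'b \<Rightarrow> real. D (B (curry u 0)))"
  define z2 where "z2 = (\<lambda>u :: nat \<times> 'b \<Rightarrow> real. Q (reindex (\<lambda>i. Some (Suc i)) u) + (u - Q u))"
  define merge where "merge = (\<lambda>u :: nat \<times> 'b \<Rightarrow> real. reindex (\<lambda>i. if even i then Some (i div 2) else None) (z1 u) 
      + reindex (\<lambda>i. if odd i then Some (i div 2) else None) (z2 u))"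
  define S where "S = (\<lambda>u :: nat \<times> 'b \<Rightarrow> real. B (curry u 0) - C (z1 u) + C (merge u))"

  have re: "bounded_linear_map Z NZ Z NZ (reindex \<pi>)" for \<pi>
    unfolding Z_def NZ_def by (rule blm_reindex[OF X])
  have bQ: "bounded_linear_map Z NZ Z NZ Q"
    unfolding Z_def NZ_def Q_def by (intro blm_linf_lift X blm_compose[OF X Y B A])
  have bcomp: "bounded_linear_map Z NZ X P (\<lambda>u. curry u j)" for j
    unfolding Z_def NZ_def by (rule blm_component)
  have bhd: "bounded_linear_map X P Z NZ hd"
    unfolding hd_def
    by (rule blm_compose[OF X Z _ re]) (simp only: Z_def NZ_def blm_diagonal[OF X])
  have bev: "bounded_linear_map Y N Z NZ evens" and bod: "bounded_linear_map Y N Z NZ odds"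
    unfolding evens_def odds_def comp_def by (intro blm_compose[OF Y Z D] re)+
  have by1: "bounded_linear_map Y N Y N y1"
    unfolding y1_def
    by (intro blm_plus blm_minus Y blm_id blm_compose[OF Y Z D C] blm_compose[OF Y Z bev C])
  have bT: "bounded_linear_map Y N Z NZ T"
    unfolding T_def
    by (intro blm_plus[OF Y Z] blm_minus[OF Y Z] bod blm_compose[OF Y X _ bhd] blm_compose[OF Y Y by1 A]
        blm_compose[OF Y Z bod bQ] blm_compose[OF Y Z _ re])
  have bB0: "bounded_linear_map Z NZ Y N (\<lambda>u. B (curry u 0))"
    by (intro blm_compose[OF Z X bcomp B])
  have bz1: "bounded_linear_map Z NZ Z NZ z1"
    unfolding z1_def by (intro blm_compose[OF Z Y bB0 D])
  have bz2: "bounded_linear_map Z NZ Z NZ z2"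
    unfolding z2_def by (intro blm_plus[OF Z Z] blm_minus[OF Z Z] blm_id bQ blm_compose[OF Z Z re bQ])
  have bm: "bounded_linear_map Z NZ Z NZ merge"
    unfolding merge_def by (intro blm_plus[OF Z Z] blm_compose[OF Z Z _ re] bz1 bz2)
  have bS: "bounded_linear_map Z NZ Y N S"
    unfolding S_def
    by (intro blm_plus[OF Z Y] blm_minus[OF Z Y] bB0 blm_compose[OF Z Z bz1 C] blm_compose[OF Z Z bm C])
  note mems = blm_mem[OF A] blm_mem[OF B] blm_mem[OF C] blm_mem[OF D] blm_mem[OF bcomp] blm_mem[OF bQ]
    blm_mem[OF bev] blm_mem[OF bod] blm_mem[OF by1] blm_mem[OF bz1] blm_mem[OF bz2] blm_mem[OF bm]
    blm_mem[OF bT] blm_mem[OF bS] Y.add_mem Y.diff_mem X.add_mem X.diff_mem Z.add_mem Z.diff_mem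
  note lin = blm_add[OF A] blm_add[OF B] blm_diff[OF Y A] blm_diff[OF X B]
    blm_add[OF D] blm_diff[OF Y D] blm_add[OF C] blm_diff[OF Z C]
  have cQ: "curry (Q z) i = A (B (curry z i))" for z i
    by (simp add: Q_def curry_linf_lift)
  have hd0: "curry (hd f) i = (if i = 0 then f else 0)" for f i
    by (simp add: hd_def reindex_def fun_eq_iff)
  note cur = cQ hd0 curry_add curry_diff curry_reindex
  have T0: "curry (T y) 0 = A (y1 y) + (curry (odds y) 0 - A (B (curry (odds y) 0)))" for y
    by (simp add: T_def cur)
  have TS: "curry (T y) (Suc i) = 
      A (B (curry (odds y) i)) + (curry (odds y) (Suc i) - A (B (curry (odds y) (Suc i))))" for y i
    by (simp add: T_def cur)
  have z2c: "curry (z2 u) i = A (B (curry u (Suc i))) + (curry u i - A (B (curry u i)))" for u i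
    by (simp add: z2_def cur)
  have merge: "merge u = z" 
    if "\<And>i. curry (z1 u) i = curry z (2 * i)" "\<And>i. curry (z2 u) i = curry z (2 * i + 1)" for u z
    by (rule linf_eqI) (use that in \<open>auto simp: merge_def cur elim!: evenE oddE\<close>)

  have ST: "S (T y) = y" if y: "y \<in> Y" for y
  proof -
    \<comment> \<open>\<open>B\<close> vanishes on each complementary part
      \<open>x - A (B x)\<close>, because \<open>B (A y) = y\<close>.\<close>
    have BT0: "B (curry (T y) 0) = y1 y"
      using y by (simp add: T0 lin mems BA)
    have BTS: "B (curry (T y) (Suc i)) = B (curry (odds y) i)" for i
      using y by (simp add: TS lin mems BA)
    have "D (y1 y) = evens y"
      using y by (simp add: y1_def lin mems DC)
    then have z1: "z1 (T y) = evens y"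
      by (simp add: z1_def BT0)
    have z2: "curry (z2 (T y)) i = curry (odds y) i" for i
    proof (cases i)
      case 0
      then show ?thesis by (simp add: z2c BT0 BTS) (simp add: T0)
    next
      case (Suc j)
      then show ?thesis by (simp add: z2c BTS) (simp add: TS)
    qed
    have "merge (T y) = D y"
      by (rule merge) (simp_all add: z1 z2 evens_def odds_def cur)
    then show ?thesis
      by (simp add: S_def BT0 z1) (simp add: y1_def)
  qed
  have TS: "T (S u) = u" if u: "u \<in> Z" for u
  proof -
    have Bz2: "B (curry (z2 u) i) = B (curry u (Suc i))" for i
      using u by (simp add: z2c lin mems BA)
    have DS: "D (S u) = merge u"
      using u by (simp add: S_def lin mems DC) (simp add: z1_def)
    have ev: "evens (S u) = z1 u"
      by (rule linf_eqI) (simp add: evens_def DS merge_def cur)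
    have od: "odds (S u) = z2 u"
      by (rule linf_eqI) (simp add: odds_def DS merge_def cur)
    have y1: "y1 (S u) = B (curry u 0)"
      by (simp add: y1_def DS ev) (simp add: S_def)
    show ?thesis
    proof (rule linf_eqI)
      fix i show "curry (T (S u)) i = curry u i"
      proof (cases i)
        case 0
        then show ?thesis by (simp add: T0 od y1 Bz2) (simp add: z2c)
      next
        case (Suc j)
        then show ?thesis by (simp add: TS od Bz2) (simp add: z2c)
      qed
    qed
  qed
  show ?thesis
    using linearly_isomorphicI[OF Y Z bT bS ST TS] unfolding Z_def NZ_def .
qed

subsection \<open>Spaces of Lipschitz functions\<close>

text \<open>The norm is the least Lipschitz constant, so operator bounds can be proved for Lipschitz
  constants and converted by \<open>lip_norm_le\<close>.\<close>

lemma lip_norm_lipschitz: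
  assumes "L-lipschitz_on X f"
  shows "(lip_norm X f)-lipschitz_on X f" and lip_norm_le: "lip_norm X f \<le> L"
proof -
  define S where "S = insert 0 {(f x - f y) / dist x y | x y. x \<in> X \<and> y \<in> X \<and> x \<noteq> y}"
  have N: "lip_norm X f = Sup S" by (simp add: lip_norm_def S_def)
  have up: "s \<le> L" if "s \<in> S" for s
  proof -
    have "f x - f y \<le> L * dist x y" if "x \<in> X" "y \<in> X" for x y
      using lipschitz_onD[OF assms that] by (simp add: dist_real_def)
    then show ?thesis
      using that lipschitz_on_nonneg[OF assms] by (auto simp: S_def divide_le_eq)
  qed
  then have bdd: "bdd_above S" by (auto simp: bdd_above_def)
  show "lip_norm X f \<le> L"
    unfolding N by (rule cSup_least) (use up in \<open>auto simp: S_def\<close>)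
  have *: "f x - f y \<le> lip_norm X f * dist x y" if "x \<in> X" "y \<in> X" for x y
  proof (cases "x = y")
    case False
    then have "(f x - f y) / dist x y \<le> Sup S"
      using that by (intro cSup_upper[OF _ bdd]) (auto simp: S_def)
    then show ?thesis using False by (simp add: N divide_le_eq)
  qed simp
  show "(lip_norm X f)-lipschitz_on X f"
  proof (rule lipschitz_onI)
    show "0 \<le> lip_norm X f" unfolding N by (rule cSup_upper[OF _ bdd]) (simp add: S_def)
    show "dist (f x) (f y) \<le> lip_norm X f * dist x y" if "x \<in> X" "y \<in> X" for x y
      using *[OF that] *[OF that(2,1)] by (auto simp: dist_real_def dist_commute)
  qed
qed

lemma Lip0_lipschitz: "f \<in> Lip0 X b \<Longrightarrow> (lip_norm X f)-lipschitz_on X f"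
  unfolding Lip0_def using lip_norm_lipschitz(1) by blast

lemma Lip0I: "L-lipschitz_on X f \<Longrightarrow> f b = 0 \<Longrightarrow> (\<And>x. x \<notin> X \<Longrightarrow> f x = 0) \<Longrightarrow> f \<in> Lip0 X b"
  unfolding Lip0_def by blast

lemma Lip0_normed_function_space: "normed_function_space (Lip0 X b) (lip_norm X)"
proof
  show "0 \<in> Lip0 X b"
    by (rule Lip0I[where L=0]) (auto simp: zero_fun_def intro: lipschitz_on_constant)
next
  fix f g assume fg: "f \<in> Lip0 X b" "g \<in> Lip0 X b"
  have L: "(lip_norm X f + lip_norm X g)-lipschitz_on X (f + g)"
    unfolding plus_fun_def using fg[THEN Lip0_lipschitz] by (rule lipschitz_on_add)
  show "f + g \<in> Lip0 X b"
    using fg by (intro Lip0I[OF L]) (auto simp: Lip0_def)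
  show "lip_norm X (f + g) \<le> lip_norm X f + lip_norm X g"
    by (rule lip_norm_le[OF L])
next
  fix f c assume f: "f \<in> Lip0 X b"
  have L: "(\<bar>c\<bar> * lip_norm X f)-lipschitz_on X (\<lambda>x. c * f x)"
    using f[THEN Lip0_lipschitz] by (rule lipschitz_on_cmult_real)
  show "(\<lambda>x. c * f x) \<in> Lip0 X b"
    using f by (intro Lip0I[OF L]) (auto simp: Lip0_def)
  show "lip_norm X (\<lambda>x. c * f x) \<le> \<bar>c\<bar> * lip_norm X f"
    by (rule lip_norm_le[OF L])
next
  show "0 \<le> lip_norm X f" if "f \<in> Lip0 X b" for f
    using that Lip0_lipschitz lipschitz_on_nonneg by blast
qed

lemma lipschitz_on_diff_const: "L-lipschitz_on X f \<Longrightarrow> L-lipschitz_on X (\<lambda>x. f x - c)"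
  for f :: "'a::metric_space \<Rightarrow> real"
  by (simp add: lipschitz_on_def dist_real_def)

text \<open>Subtracting the value at the new base point adapts extension and restriction without
  changing Lipschitz constants; in \<open>B (A f)\<close> the constants cancel since
  \<open>f a = 0\<close>.\<close>

lemma Lip0_complemented_in_Lip0_UNIV:
  fixes M :: "'a::euclidean_space set" and b :: 'a
  assumes a: "a \<in> M"
  obtains A B where "bounded_linear_map (Lip0 M a) (lip_norm M) (Lip0 UNIV b) (lip_norm UNIV) A"
    "bounded_linear_map (Lip0 UNIV b) (lip_norm UNIV) (Lip0 M a) (lip_norm M) B"
    "\<And>f. f \<in> Lip0 M a \<Longrightarrow> B (A f) = f"
proof -
  have "M \<noteq> {}" using a by auto
  then obtain K E where K: "K \<ge> 0"
    and E1: "\<And>f L. L-lipschitz_on M f \<Longrightarrow> (K * L)-lipschitz_on UNIV (E f)"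
    and E2: "\<And>f L x. L-lipschitz_on M f \<Longrightarrow> x \<in> M \<Longrightarrow> E f x = (f x :: real)"
    and E3: "\<And>f g L L'. L-lipschitz_on M f \<Longrightarrow> L'-lipschitz_on M g \<Longrightarrow> E (\<lambda>x. f x + g x) = (\<lambda>x. E f x + E g x)"
    and E4: "\<And>f c L. L-lipschitz_on M f \<Longrightarrow> E (\<lambda>x. c * f x) = (\<lambda>x. c * E f x)"
    by (rule lipschitz_extension_operator) blast
  define A where "A = (\<lambda>f x. E f x - E f b)"
  define B where "B = (\<lambda>h x. if x \<in> M then h x - h a else 0 :: real)"
  have AL: "(K * lip_norm M f)-lipschitz_on UNIV (A f)" if "f \<in> Lip0 M a" for f
    unfolding A_def by (intro lipschitz_on_diff_const E1 Lip0_lipschitz[OF that])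
  have BL: "(1 * lip_norm UNIV h)-lipschitz_on M (B h)" if "h \<in> Lip0 UNIV b" for h
    using lipschitz_on_subset[OF lipschitz_on_diff_const[OF Lip0_lipschitz[OF that], of "h a"], of M]
    by (simp add: B_def lipschitz_on_def)
  show ?thesis
  proof (rule that[of A B])
    show "bounded_linear_map (Lip0 M a) (lip_norm M) (Lip0 UNIV b) (lip_norm UNIV) A"
    proof (rule blmI[where C=K])
      fix f assume f: "f \<in> Lip0 M a"
      show "A f \<in> Lip0 UNIV b" by (rule Lip0I[OF AL[OF f]]) (auto simp: A_def)
      show "lip_norm UNIV (A f) \<le> K * lip_norm M f" by (rule lip_norm_le[OF AL[OF f]])
      show "A (\<lambda>x. c * f x) = (\<lambda>x. c * A f x)" for c
        by (simp add: A_def E4[OF Lip0_lipschitz[OF f]] algebra_simps)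
      fix g assume g: "g \<in> Lip0 M a"
      show "A (f + g) = A f + A g"
        by (simp add: A_def plus_fun_def E3[OF f[THEN Lip0_lipschitz] g[THEN Lip0_lipschitz]] algebra_simps)
    qed
    show "bounded_linear_map (Lip0 UNIV b) (lip_norm UNIV) (Lip0 M a) (lip_norm M) B"
    proof (rule blmI[where C=1])
      fix h assume h: "h \<in> Lip0 UNIV b"
      show "B h \<in> Lip0 M a" by (rule Lip0I[OF BL[OF h]]) (auto simp: B_def)
      show "lip_norm M (B h) \<le> 1 * lip_norm UNIV h" by (rule lip_norm_le[OF BL[OF h]])
    qed (auto simp: B_def fun_eq_iff algebra_simps)
    fix f assume f: "f \<in> Lip0 M a"
    then have "f a = 0" "\<And>x. x \<notin> M \<Longrightarrow> f x = 0" by (auto simp: Lip0_def)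
    then show "B (A f) = f"
      using E2[OF Lip0_lipschitz[OF f]] a by (auto simp: B_def A_def fun_eq_iff)
  qed
qed

section \<open>Truncation and gluing\<close>

text \<open>The tent factor tends to \<open>1\<close> at each point as \<open>R\<close> grows, so
  the truncation is undone in the limit.\<close>

definition bump :: "real \<Rightarrow> ('a::real_normed_vector \<Rightarrow> real) \<Rightarrow> 'a \<Rightarrow> real" where
  "bump R f x = f x * max 0 (1 - norm x / R)"

lemma bump_lipschitz:
  assumes f: "L-lipschitz_on UNIV f" "f 0 = 0" and R: "R > 0"
  shows "(2 * L)-lipschitz_on UNIV (bump R f)"
proof (rule lipschitz_onI)
  define \<phi> where "\<phi> = (\<lambda>x::'a. max 0 (1 - norm x / R))"
  have L: "L \<ge> 0" using f(1) by (rule lipschitz_on_nonneg)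
  have \<phi>: "\<bar>\<phi> x - \<phi> y\<bar> \<le> dist x y / R" for x y
  proof -
    have "\<bar>(1 - norm x / R) - (1 - norm y / R)\<bar> = \<bar>norm x - norm y\<bar> / R"
      using R by (simp flip: diff_divide_distrib add: abs_minus_commute)
    also have "\<dots> \<le> dist x y / R"
      using R norm_triangle_ineq3[of x y] by (intro divide_right_mono) (auto simp: dist_norm)
    finally show ?thesis unfolding \<phi>_def by linarith
  qed
  have \<phi>1: "0 \<le> \<phi> x" "\<phi> x \<le> 1" for x using R by (auto simp: \<phi>_def)
  have main: "\<bar>bump R f x - bump R f y\<bar> \<le> 2 * L * dist x y" if x: "norm x \<le> R" for x y
  proof -
    have fx: "\<bar>f x\<bar> \<le> L * R"
      using lipschitz_onD[OF f(1), of x 0] mult_left_mono[OF x L] by (simp add: f(2) dist_real_def)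
    \<comment> \<open>The product rule is arranged so that \<open>f\<close> alone is evaluated at
      \<open>x\<close>, the point known to lie in the ball.\<close>
    have "bump R f x - bump R f y = (f x - f y) * \<phi> y + f x * (\<phi> x - \<phi> y)"
      by (simp add: bump_def \<phi>_def algebra_simps)
    also have "\<bar>\<dots>\<bar> \<le> \<bar>f x - f y\<bar> * \<bar>\<phi> y\<bar> + \<bar>f x\<bar> * \<bar>\<phi> x - \<phi> y\<bar>"
      by (metis abs_mult abs_triangle_ineq)
    also have "\<dots> \<le> L * dist x y * 1 + L * R * (dist x y / R)"
      using fx \<phi> \<phi>1 L R lipschitz_onD[OF f(1), of x y]
      by (intro add_mono mult_mono) (auto simp: dist_real_def)
    also have "\<dots> = 2 * L * dist x y" using R by simp
    finally show ?thesis .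
  qed
  fix x y
  show "dist (bump R f x) (bump R f y) \<le> 2 * L * dist x y"
  proof (cases "norm x \<le> R \<or> norm y \<le> R")
    case True
    then show ?thesis using main[of x y] main[of y x] by (auto simp: dist_real_def dist_commute)
  next
    case False
    then have "bump R f x = 0" "bump R f y = 0" using R by (auto simp: bump_def max_def field_simps)
    then show ?thesis using L by simp
  qed
qed (use f lipschitz_on_nonneg in auto)

definition glue :: "(nat \<Rightarrow> 'a set) \<Rightarrow> (nat \<Rightarrow> 'a \<Rightarrow> real) \<Rightarrow> 'a \<Rightarrow> real" where
  "glue B h x = (if \<exists>m. x \<in> B m then h (SOME m. x \<in> B m) x else 0)"

lemma glue_eq:
  assumes "disjoint_family B" "x \<in> B m"
  shows "glue B h x = h m x"
proof -
  have "(SOME k. x \<in> B k) = m"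
    using assms by (intro some_equality) (auto simp: disjoint_family_on_def)
  then show ?thesis using assms(2) by (auto simp: glue_def)
qed

text \<open>For points of two different sets each function vanishes at the other point, so the
  difference splits into one difference of each function; hence a factor 2 however many sets there
  are.\<close>

lemma glue_lipschitz:
  assumes B: "disjoint_family B" and h: "\<And>m. L-lipschitz_on UNIV (h m)" and z: "\<And>m x. x \<notin> B m \<Longrightarrow> h m x = 0"
  shows "(2 * L)-lipschitz_on UNIV (glue B h)"
proof (rule lipschitz_onI)
  have L: "L \<ge> 0" using h by (rule lipschitz_on_nonneg)
  then show "0 \<le> 2 * L" by simp
  have hm: "\<bar>h m x - h m y\<bar> \<le> L * dist x y" for m x y
    using lipschitz_onD[OF h, of x y] by (simp add: dist_real_def)
  have LL: "L * dist x y \<le> 2 * L * dist x y" for x y :: 'a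
    using L mult_right_mono[of L "2 * L" "dist x y"] by simp
  have one: "\<bar>glue B h x - glue B h y\<bar> \<le> 2 * L * dist x y" if x: "x \<in> B m" for x y m
  proof (cases "\<exists>n. y \<in> B n")
    case True
    then obtain n where n: "y \<in> B n" ..
    show ?thesis
    proof (cases "n = m")
      case True
      then show ?thesis using hm[of m x y] LL[of x y] n x by (simp add: glue_eq[OF B])
    next
      case False
      then have "h m y = 0" "h n x = 0" using x n B by (auto intro!: z simp: disjoint_family_on_def)
      then show ?thesis using hm[of m x y] hm[of n x y] n x by (simp add: glue_eq[OF B])
    qed
  next
    case False
    then have "glue B h y = h m y" by (auto simp: glue_def z)
    then show ?thesis using hm[of m x y] LL[of x y] x by (simp add: glue_eq[OF B])
  qed
  fix x y
  show "dist (glue B h x) (glue B h y) \<le> 2 * L * dist x y"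
  proof (cases "(\<exists>m. x \<in> B m) \<or> (\<exists>m. y \<in> B m)")
    case True
    then show ?thesis using one[of x _ y] one[of y _ x] by (auto simp: dist_real_def dist_commute abs_minus_commute)
  next
    case False
    then show ?thesis using L by (simp add: glue_def)
  qed
qed

section \<open>Blow-ups along balls in which the set is nearly dense\<close>

text \<open>In the coordinate \<open>(x - c m) /\<^sub>R s m\<close> the \<open>m\<close>-th ball
  has radius \<open>m + 1\<close> and \<open>M\<close> is \<open>1 / (m + 1)\<close>-dense in it:
  the windows exhaust the space while the mesh tends to \<open>0\<close>. Fixing \<open>U\<close>
  makes \<open>blowup_limit\<close> one map for all functions.\<close>

locale dense_balls =
  fixes M :: "'a::euclidean_space set" and c :: "nat \<Rightarrow> 'a" and s :: "nat \<Rightarrow> real" and U :: "nat filter"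
  assumes s: "s m > 0"
    and disj: "disjoint_family (\<lambda>m. ball (c m) (s m * (real m + 1)))"
    and dense: "y \<in> ball (c m) (s m * (real m + 1)) \<Longrightarrow> \<exists>q\<in>M. dist q y < s m / (real m + 1)"
    and U: "ultra U" "U \<le> sequentially"
begin

text \<open>This scaling preserves Lipschitz constants, and the truncation radius
  \<open>m + 1\<close> corresponds to the boundary of the ball.\<close>

definition piece :: "nat \<Rightarrow> ('a \<Rightarrow> real) \<Rightarrow> 'a \<Rightarrow> real" where
  "piece m f x = s m * bump (real m + 1) f ((x - c m) /\<^sub>R s m)"

text \<open>The \<open>j\<close>-th function is copied into the balls with indices \<open>prod_encode (j, k)\<close>.\<close>

definition spread :: "(nat \<times> 'a \<Rightarrow> real) \<Rightarrow> 'a \<Rightarrow> real" where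
  "spread F = glue (\<lambda>m. ball (c m) (s m * (real m + 1))) (\<lambda>m. piece m (curry F (fst (prod_decode m))))"

text \<open>Stands in for \<open>c m + s m *\<^sub>R x\<close>, where a function on \<open>M\<close>
  carries no information. The choice does not depend on the function, which keeps
  \<open>blowup\<close> linear; it is meaningful for \<open>norm x < m + 1\<close>, that is, for all
  large \<open>m\<close>.\<close>

definition near :: "nat \<Rightarrow> 'a \<Rightarrow> 'a" where
  "near m x = (SOME q. q \<in> M \<and> dist q (c m + s m *\<^sub>R x) < s m / (real m + 1))"

text \<open>Subtracting the value at \<open>near m 0\<close> makes the limit vanish at
  \<open>0\<close> and removes additive constants.\<close>

definition blowup :: "nat \<Rightarrow> ('a \<Rightarrow> real) \<Rightarrow> 'a \<Rightarrow> real" where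
  "blowup m g x = (g (near m x) - g (near m 0)) / s m"

definition blowup_limit :: "('a \<Rightarrow> real) \<Rightarrow> nat \<times> 'a \<Rightarrow> real" where
  "blowup_limit g = (\<lambda>(j, x). Lim U (\<lambda>k. blowup (prod_encode (j, k)) g x))"

lemma near:
  assumes "norm x < real m + 1"
  shows "near m x \<in> M" "dist (near m x) (c m + s m *\<^sub>R x) < s m / (real m + 1)"
proof -
  have "c m + s m *\<^sub>R x \<in> ball (c m) (s m * (real m + 1))"
    using assms s[of m] by (simp add: dist_norm)
  from dense[OF this] have "\<exists>q. q \<in> M \<and> dist q (c m + s m *\<^sub>R x) < s m / (real m + 1)" by blast
  from someI_ex[OF this] show "near m x \<in> M" "dist (near m x) (c m + s m *\<^sub>R x) < s m / (real m + 1)"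
    by (simp_all add: near_def)
qed

lemma piece_lipschitz:
  assumes "L-lipschitz_on UNIV f" "f 0 = 0"
  shows "(2 * L)-lipschitz_on UNIV (piece m f)"
proof (rule lipschitz_onI)
  have b: "(2 * L)-lipschitz_on UNIV (bump (real m + 1) f)"
    using assms by (intro bump_lipschitz) auto
  show "0 \<le> 2 * L" using b by (rule lipschitz_on_nonneg)
  fix x y
  have "dist (piece m f x) (piece m f y)
     = s m * dist (bump (real m + 1) f ((x - c m) /\<^sub>R s m)) (bump (real m + 1) f ((y - c m) /\<^sub>R s m))"
    using s[of m] by (simp add: piece_def dist_real_def abs_mult flip: right_diff_distrib)
  also have "\<dots> \<le> s m * (2 * L * dist ((x - c m) /\<^sub>R s m) ((y - c m) /\<^sub>R s m))"
    using s[of m] by (intro mult_left_mono lipschitz_onD[OF b]) auto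
  also have "dist ((x - c m) /\<^sub>R s m) ((y - c m) /\<^sub>R s m) = dist x y / s m"
    using s[of m] by (simp add: dist_norm divide_inverse flip: scaleR_diff_right)
  finally show "dist (piece m f x) (piece m f y) \<le> 2 * L * dist x y"
    using s[of m] by simp
qed

lemma piece_outside: "x \<notin> ball (c m) (s m * (real m + 1)) \<Longrightarrow> piece m f x = 0"
proof -
  assume "x \<notin> ball (c m) (s m * (real m + 1))"
  moreover have "norm ((x - c m) /\<^sub>R s m) = dist (c m) x / s m"
    using s[of m] by (simp add: dist_norm norm_minus_commute divide_inverse)
  ultimately have "real m + 1 \<le> norm ((x - c m) /\<^sub>R s m)"
    using s[of m] by (simp add: pos_le_divide_eq ac_simps)
  then show ?thesis by (simp add: piece_def bump_def pos_le_divide_eq)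
qed

lemma spread_lipschitz:
  assumes "\<And>j. L-lipschitz_on UNIV (curry F j)" "\<And>j. F (j, 0) = 0"
  shows "(4 * L)-lipschitz_on UNIV (spread F)"
proof -
  have "(2 * (2 * L))-lipschitz_on UNIV (spread F)"
    unfolding spread_def using assms
    by (intro glue_lipschitz disj piece_lipschitz piece_outside) auto
  then show ?thesis by simp
qed

lemma spread_add: "spread (F + G) = spread F + spread G"
  and spread_scale: "spread (\<lambda>p. b * F p) = (\<lambda>x. b * spread F x)"
  by (auto simp: spread_def glue_def piece_def bump_def fun_eq_iff algebra_simps)

lemma eventually_norm_less: "eventually (\<lambda>k. norm (x::'a) < real (prod_encode (j, k)) + 1) sequentially"
proof -
  obtain N :: nat where N: "norm x < real N" using reals_Archimedean2 by blast
  show ?thesis unfolding eventually_sequentially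
  proof (intro exI[of _ N] allI impI)
    fix k assume "N \<le> k"
    then have "N \<le> prod_encode (j, k)" using le_prod_encode_2 le_trans by blast
    then show "norm x < real (prod_encode (j, k)) + 1" using N by linarith
  qed
qed

text \<open>Each of the two points of \<open>M\<close> is off by less than
  \<open>s m / (m + 1)\<close>; after rescaling this is the term \<open>2 / (m + 1)\<close>, which
  disappears in the limit.\<close>

lemma blowup_diff:
  assumes g: "L-lipschitz_on M g" and x: "norm x < real m + 1" "norm y < real m + 1"
  shows "\<bar>blowup m g x - blowup m g y\<bar> \<le> L * (dist x y + 2 / (real m + 1))"
proof -
  have "dist (near m x) (near m y) \<le> dist (near m x) (c m + s m *\<^sub>R x) 
      + dist (c m + s m *\<^sub>R x) (c m + s m *\<^sub>R y) + dist (near m y) (c m + s m *\<^sub>R y)"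
    using dist_triangle[of "near m x" "near m y" "c m + s m *\<^sub>R x"]
      dist_triangle[of "c m + s m *\<^sub>R x" "near m y" "c m + s m *\<^sub>R y"]
    by (simp add: dist_commute)
  also have "dist (c m + s m *\<^sub>R x) (c m + s m *\<^sub>R y) = s m * dist x y"
    using s[of m] by (simp add: dist_norm flip: scaleR_diff_right)
  finally have "dist (near m x) (near m y) \<le> s m * dist x y + (s m / (real m + 1) + s m / (real m + 1))"
    using near(2)[OF x(1)] near(2)[OF x(2)] by linarith
  then have d: "dist (near m x) (near m y) \<le> s m * (dist x y + 2 / (real m + 1))"
    by (simp add: distrib_left mult.commute)
  have "\<bar>blowup m g x - blowup m g y\<bar> = \<bar>g (near m x) - g (near m y)\<bar> / s m"
    using s[of m] by (simp add: blowup_def flip: diff_divide_distrib)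
  also have "\<dots> \<le> L * dist (near m x) (near m y) / s m"
    using lipschitz_onD[OF g near(1)[OF x(1)] near(1)[OF x(2)]] s[of m]
    by (intro divide_right_mono) (auto simp: dist_real_def)
  also have "\<dots> \<le> L * (s m * (dist x y + 2 / (real m + 1))) / s m"
    using d s[of m] lipschitz_on_nonneg[OF g] by (intro divide_right_mono mult_left_mono) auto
  also have "\<dots> = L * (dist x y + 2 / (real m + 1))" using s[of m] by simp
  finally show ?thesis .
qed

lemma U_ne_bot: "U \<noteq> bot"
  using U by (simp add: ultra_def)

lemma eventually_U: "eventually P sequentially \<Longrightarrow> eventually P U"
  using U(2) by (rule filter_leD)

lemma blowup_tendsto:
  assumes g: "L-lipschitz_on M g"
  shows "((\<lambda>k. blowup (prod_encode (j, k)) g x) \<longlongrightarrow> curry (blowup_limit g) j x) U"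
proof -
  have "eventually (\<lambda>k. \<bar>blowup (prod_encode (j, k)) g x\<bar> \<le> L * (norm x + 2)) U"
    using eventually_norm_less[THEN eventually_U]
  proof (rule eventually_mono)
    fix k let ?m = "prod_encode (j, k)"
    assume "norm x < real ?m + 1"
    then have "\<bar>blowup ?m g x - blowup ?m g 0\<bar> \<le> L * (dist x 0 + 2 / (real ?m + 1))"
      by (intro blowup_diff[OF g]) auto
    also have "\<dots> \<le> L * (norm x + 2)"
      using lipschitz_on_nonneg[OF g] by (intro mult_left_mono) (auto simp: divide_le_eq)
    finally show "\<bar>blowup ?m g x\<bar> \<le> L * (norm x + 2)" by (simp add: blowup_def)
  qed
  from ultra_bounded_tendsto[OF U(1) this] show ?thesis by (simp add: blowup_limit_def)
qed

lemma blowup_limit_eqI: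
  assumes "((\<lambda>k. blowup (prod_encode (j, k)) g x) \<longlongrightarrow> l) U"
  shows "curry (blowup_limit g) j x = l"
  using tendsto_Lim[OF U_ne_bot assms] by (simp add: blowup_limit_def)

lemma blowup_limit_lipschitz:
  assumes g: "L-lipschitz_on M g"
  shows "L-lipschitz_on UNIV (curry (blowup_limit g) j)"
proof (rule lipschitz_onI)
  fix x y
  show "dist (curry (blowup_limit g) j x) (curry (blowup_limit g) j y) \<le> L * dist x y"
  proof (rule tendsto_le[OF U_ne_bot])
    have "(\<lambda>k. L * (dist x y + 2 * inverse (real (Suc k)))) \<longlonglongrightarrow> L * (dist x y + 2 * 0)"
      by (intro tendsto_mult tendsto_add tendsto_const LIMSEQ_inverse_real_of_nat)
    from tendsto_mono[OF U(2) this]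
    show "((\<lambda>k. L * (dist x y + 2 * inverse (real (Suc k)))) \<longlongrightarrow> L * dist x y) U"
      by (simp only: mult_zero_right add_0_right)
    show "((\<lambda>k. dist (blowup (prod_encode (j, k)) g x) (blowup (prod_encode (j, k)) g y))
       \<longlongrightarrow> dist (curry (blowup_limit g) j x) (curry (blowup_limit g) j y)) U"
      by (intro tendsto_dist blowup_tendsto[OF g])
    show "\<forall>\<^sub>F k in U. dist (blowup (prod_encode (j, k)) g x) (blowup (prod_encode (j, k)) g y)
            \<le> L * (dist x y + 2 * inverse (real (Suc k)))"
      using eventually_conj[OF eventually_norm_less[of x j, THEN eventually_U] 
          eventually_norm_less[of y j, THEN eventually_U]]
    proof (rule eventually_mono)
      fix k let ?m = "prod_encode (j, k)"
      assume "norm x < real ?m + 1 \<and> norm y < real ?m + 1"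
      then have "\<bar>blowup ?m g x - blowup ?m g y\<bar> \<le> L * (dist x y + 2 / (real ?m + 1))"
        by (intro blowup_diff[OF g]) auto
      also have "\<dots> \<le> L * (dist x y + 2 * inverse (real (Suc k)))"
      proof (intro mult_left_mono add_left_mono)
        show "2 / (real ?m + 1) \<le> 2 * inverse (real (Suc k))"
          using le_prod_encode_2[of k j] by (simp add: divide_inverse[symmetric] frac_le)
      qed (rule lipschitz_on_nonneg[OF g])
      finally show "dist (blowup ?m g x) (blowup ?m g y) \<le> L * (dist x y + 2 * inverse (real (Suc k)))"
        by (simp add: dist_real_def)
    qed
  qed
qed (rule lipschitz_on_nonneg[OF g])

text \<open>Two errors add up: moving from \<open>x\<close> to \<open>x'\<close> costs
  \<open>2 * L / R\<close>, and the tent factor at \<open>x\<close> differs from \<open>1\<close> by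
  \<open>norm x / R\<close>.\<close>

lemma bump_near:
  assumes f: "L-lipschitz_on UNIV f" "f 0 = 0" and x: "norm x \<le> R" "R > 0" and d: "dist x' x \<le> 1 / R"
  shows "\<bar>bump R f x' - f x\<bar> \<le> (2 * L + \<bar>f x\<bar> * norm x) / R"
proof -
  have "\<bar>bump R f x' - bump R f x\<bar> \<le> 2 * L * dist x' x"
    using lipschitz_onD[OF bump_lipschitz[OF f x(2)], of x' x] by (simp add: dist_real_def)
  also have "\<dots> \<le> 2 * L * (1 / R)"
    using d lipschitz_on_nonneg[OF f(1)] by (intro mult_left_mono) auto
  finally have 1: "\<bar>bump R f x' - bump R f x\<bar> \<le> 2 * L * (1 / R)" .
  have "bump R f x - f x = - (f x * (norm x / R))"
    using x by (simp add: bump_def max_def field_simps)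
  then have "\<bar>bump R f x - f x\<bar> = \<bar>f x\<bar> * norm x / R"
    using x by (simp add: abs_mult)
  with 1 show ?thesis by (simp add: add_divide_distrib)
qed

text \<open>At the indices \<open>prod_encode (j, k)\<close> the window shows only the
  \<open>j\<close>-th function, so the blow-ups converge to it even in the ordinary sense. The
  constant \<open>b\<close> accounts for the change of base point and cancels in
  \<open>blowup\<close>.\<close>

lemma blowup_limit_spread:
  assumes F: "\<And>j. L-lipschitz_on UNIV (curry F j)" "\<And>j. F (j, 0) = 0"
    and g: "\<And>q. q \<in> M \<Longrightarrow> g q = spread F q - b"
  shows "blowup_limit g = F"
proof (intro linf_eqI ext)
  fix j x
  define f where "f = curry F j"
  have f: "L-lipschitz_on UNIV f" "f 0 = 0" using F by (auto simp: f_def)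
  have L: "L \<ge> 0" using f(1) by (rule lipschitz_on_nonneg)
  have val: "\<bar>g (near m y) / s m + b / s m - f y\<bar> \<le> (2 * L + \<bar>f y\<bar> * norm y) / (real m + 1)"
    if m: "m = prod_encode (j, k)" and y: "norm y < real m" for m k y
  proof -
    define q where "q = near m y"
    define y' where "y' = (q - c m) /\<^sub>R s m"
    have q: "q \<in> M" "dist q (c m + s m *\<^sub>R y) < s m / (real m + 1)"
      using near[of y m] y by (auto simp: q_def)
    have "y' - y = (q - (c m + s m *\<^sub>R y)) /\<^sub>R s m"
      using s[of m] by (simp add: y'_def algebra_simps)
    then have "dist y' y = dist q (c m + s m *\<^sub>R y) / s m"
      using s[of m] by (simp add: dist_norm divide_inverse)
    also have "\<dots> \<le> (s m / (real m + 1)) / s m"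
      using q(2) s[of m] by (intro divide_right_mono) auto
    finally have y': "dist y' y \<le> 1 / (real m + 1)" using s[of m] by simp
    \<comment> \<open>Assuming \<open>norm y < m\<close> instead of \<open>m + 1\<close> leaves room
      for the displacement by at most 1, so \<open>q\<close> still lies in the ball.\<close>
    have "norm y' < real m + 1"
    proof -
      have "norm y' \<le> norm y + dist y' y"
        by (metis dist_norm norm_triangle_sub)
      also have "1 / (real m + 1) \<le> 1" by simp
      with y' y have "norm y + dist y' y < real m + 1" by linarith
      finally show ?thesis .
    qed
    moreover have "dist (c m) q = s m * norm y'"
      using s[of m] by (simp add: y'_def dist_norm norm_minus_commute)
    ultimately have "q \<in> ball (c m) (s m * (real m + 1))" using s[of m] by simp
    moreover have "fst (prod_decode m) = j" by (simp add: m)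
    ultimately have "spread F q = piece m f q"
      unfolding spread_def f_def by (simp only: glue_eq[OF disj])
    then have "g q / s m + b / s m = bump (real m + 1) f y'"
      using s[of m] by (simp add: g[OF q(1)] piece_def y'_def flip: add_divide_distrib)
    then show ?thesis
      using bump_near[OF f _ _ y'] y unfolding q_def by simp
  qed
  have "(\<lambda>k. blowup (prod_encode (j, k)) g x - f x) \<longlonglongrightarrow> 0"
  proof (rule Lim_null_comparison)
    \<comment> \<open>\<open>val\<close> is applied at \<open>x\<close> and at \<open>0\<close>,
      each time with an error \<open>2 * L\<close>; at \<open>0\<close> its other summand
      vanishes.\<close>
    define C where "C = 4 * L + \<bar>f x\<bar> * norm x"
    show "(\<lambda>k. C * inverse (real (Suc k))) \<longlonglongrightarrow> 0"
      by (rule tendsto_mult_right_zero[OF LIMSEQ_inverse_real_of_nat])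
    obtain N :: nat where N: "norm x < real N" using reals_Archimedean2 by blast
    show "\<forall>\<^sub>F k in sequentially. norm (blowup (prod_encode (j, k)) g x - f x) \<le> C * inverse (real (Suc k))"
      unfolding eventually_sequentially
    proof (intro exI[of _ "N"] allI impI)
      fix k assume k: "N \<le> k"
      define m where "m = prod_encode (j, k)"
      have mk: "k \<le> m" unfolding m_def by (rule le_prod_encode_2)
      then have x: "norm x < real m" using N k by linarith
      then have m0: "norm (0::'a) < real m" using norm_ge_zero[of x] by (simp del: norm_ge_zero)
      have "blowup m g x - f x = (g (near m x) / s m + b / s m - f x) - (g (near m 0) / s m + b / s m - f 0)"
        by (simp add: blowup_def f(2) diff_divide_distrib)
      then have "\<bar>blowup m g x - f x\<bar> \<le> C / (real m + 1)"
        using val[OF m_def x] val[OF m_def m0] by (simp add: C_def f(2) add_divide_distrib)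
      also have "\<dots> \<le> C / real (Suc k)"
        using mk L by (intro divide_left_mono) (auto simp: C_def)
      finally show "norm (blowup (prod_encode (j, k)) g x - f x) \<le> C * inverse (real (Suc k))"
        by (simp add: m_def divide_inverse)
    qed
  qed
  then have "(\<lambda>k. blowup (prod_encode (j, k)) g x) \<longlonglongrightarrow> f x" by (simp add: LIM_zero_iff)
  then have "((\<lambda>k. blowup (prod_encode (j, k)) g x) \<longlongrightarrow> f x) U" by (rule tendsto_mono[OF U(2)])
  then show "curry (blowup_limit g) j x = curry F j x" unfolding f_def by (rule blowup_limit_eqI)
qed

text \<open>\<open>blowup_limit\<close> is blind to additive constants, so it is a left inverse of
  \<open>C\<close> whatever the base point \<open>a\<close>.\<close>

lemma linf_complemented:
  assumes a: "a \<in> M"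
  defines "C \<equiv> \<lambda>F x. if x \<in> M then spread F x - spread F a else 0"
  shows "bounded_linear_map (linf (Lip0 UNIV 0) (lip_norm UNIV)) (linf_norm (lip_norm UNIV)) (Lip0 M a) (lip_norm M) C"
    and "bounded_linear_map (Lip0 M a) (lip_norm M) (linf (Lip0 UNIV 0) (lip_norm UNIV)) (linf_norm (lip_norm UNIV)) blowup_limit"
    and "F \<in> linf (Lip0 UNIV 0) (lip_norm UNIV) \<Longrightarrow> blowup_limit (C F) = F"
proof -
  let ?X = "Lip0 (UNIV :: 'a set) 0" and ?P = "lip_norm (UNIV :: 'a set)"
  have F1: "(linf_norm ?P F)-lipschitz_on UNIV (curry F j)" if "F \<in> linf ?X ?P" for F j
    by (rule lipschitz_on_mono[OF Lip0_lipschitz[OF linf_component[OF that]] subset_refl linf_norm_upper[OF that]])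
  have F2: "F (j, 0) = 0" if "F \<in> linf ?X ?P" for F j
    using linf_component[OF that, of j] by (simp add: Lip0_def)
  show "blowup_limit (C F) = F" if "F \<in> linf ?X ?P" for F
    by (rule blowup_limit_spread[OF F1[OF that] F2[OF that]]) (simp add: C_def)
  have CL: "(4 * linf_norm ?P F)-lipschitz_on M (C F)" if "F \<in> linf ?X ?P" for F
    using lipschitz_on_subset[OF lipschitz_on_diff_const[OF spread_lipschitz[OF F1[OF that] F2[OF that]], of "spread F a"], of M]
    by (simp add: C_def lipschitz_on_def)
  show "bounded_linear_map (linf ?X ?P) (linf_norm ?P) (Lip0 M a) (lip_norm M) C"
  proof (rule blmI[where C=4])
    fix F assume F: "F \<in> linf ?X ?P"
    show "C F \<in> Lip0 M a" by (rule Lip0I[OF CL[OF F]]) (auto simp: C_def)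
    show "lip_norm M (C F) \<le> 4 * linf_norm ?P F" by (rule lip_norm_le[OF CL[OF F]])
  qed (auto simp: C_def spread_add spread_scale fun_eq_iff algebra_simps)
  show "bounded_linear_map (Lip0 M a) (lip_norm M) (linf ?X ?P) (linf_norm ?P) blowup_limit"
  proof (rule blmI[where C=1])
    fix g assume g: "g \<in> Lip0 M a"
    note gL = Lip0_lipschitz[OF g]
    have 0: "curry (blowup_limit g) j 0 = 0" for j
      by (rule blowup_limit_eqI) (simp add: blowup_def)
    have n: "?P (curry (blowup_limit g) j) \<le> 1 * lip_norm M g" for j
      using lip_norm_le[OF blowup_limit_lipschitz[OF gL]] by simp
    show "blowup_limit g \<in> linf ?X ?P"
      by (rule linfI[where N="?P", OF _ n]) (rule Lip0I[OF blowup_limit_lipschitz[OF gL] 0], simp)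
    show "linf_norm ?P (blowup_limit g) \<le> 1 * lip_norm M g"
      by (rule linf_norm_least) (rule n)
    show "blowup_limit (\<lambda>x. b * g x) = (\<lambda>p. b * blowup_limit g p)" for b
    proof (intro linf_eqI ext)
      fix j x
      have "((\<lambda>k. b * blowup (prod_encode (j, k)) g x) \<longlongrightarrow> b * curry (blowup_limit g) j x) U"
        by (intro tendsto_intros blowup_tendsto[OF gL])
      then have "((\<lambda>k. blowup (prod_encode (j, k)) (\<lambda>x. b * g x) x) \<longlongrightarrow> b * curry (blowup_limit g) j x) U"
        by (simp add: blowup_def algebra_simps)
      from blowup_limit_eqI[OF this]
      show "curry (blowup_limit (\<lambda>x. b * g x)) j x = curry (\<lambda>p. b * blowup_limit g p) j x" by simp
    qed
    fix h assume h: "h \<in> Lip0 M a"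
    show "blowup_limit (g + h) = blowup_limit g + blowup_limit h"
    proof (intro linf_eqI ext)
      fix j x
      have "((\<lambda>k. blowup (prod_encode (j, k)) g x + blowup (prod_encode (j, k)) h x) 
          \<longlongrightarrow> curry (blowup_limit g) j x + curry (blowup_limit h) j x) U"
        by (intro tendsto_intros blowup_tendsto[OF gL] blowup_tendsto[OF Lip0_lipschitz[OF h]])
      moreover have "blowup m (g + h) x = blowup m g x + blowup m h x" for m
        by (simp add: blowup_def add_divide_distrib diff_divide_distrib)
      ultimately have "((\<lambda>k. blowup (prod_encode (j, k)) (g + h) x) 
          \<longlongrightarrow> curry (blowup_limit g) j x + curry (blowup_limit h) j x) U" by simp
      from blowup_limit_eqI[OF this]
      show "curry (blowup_limit (g + h)) j x = curry (blowup_limit g + blowup_limit h) j x" by simp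
    qed
  qed
qed

end

text \<open>The target consists of sequences of functions vanishing at \<open>0\<close>, so it
  depends neither on \<open>M\<close> nor on \<open>a\<close> and can link two different
  spaces.\<close>

lemma Lip0_isomorphic_linf:
  fixes M :: "'a::euclidean_space set"
  assumes M: "M \<in> sets lebesgue" "emeasure lebesgue M > 0" and a: "a \<in> M"
  shows "linearly_isomorphic (Lip0 M a) (lip_norm M)
    (linf (Lip0 (UNIV :: 'a set) 0) (lip_norm UNIV)) (linf_norm (lip_norm UNIV))"
proof -
  obtain c :: "nat \<Rightarrow> 'a" and r where cr: "\<And>m. r m > 0" "disjoint_family (\<lambda>m. ball (c m) (r m))"
    "\<And>m y. y \<in> ball (c m) (r m) \<Longrightarrow> \<exists>q\<in>M. dist q y < (1 / (real m + 1) ^ 2) * r m"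
  proof (rule ex_disjoint_dense_balls[OF M, where \<epsilon>="\<lambda>m. 1 / (real m + 1) ^ 2"])
    show "0 < 1 / (real m + 1) ^ 2" for m by simp
  qed blast
  obtain U where U: "U \<le> sequentially" "ultra U" 
    using ex_ultra_le[of "sequentially :: nat filter"] by auto
  \<comment> \<open>The relative mesh \<open>1 / (m + 1) ^ 2\<close> is shared out: one factor
    \<open>m + 1\<close> enlarges the rescaled window, the other refines the mesh in it.\<close>
  define s where "s = (\<lambda>m. r m / (real m + 1))"
  have sr: "s m * (real m + 1) = r m" "s m / (real m + 1) = (1 / (real m + 1) ^ 2) * r m" for m
    by (simp_all add: s_def power2_eq_square)
  interpret dense_balls M c s U
  proof
    show "0 < s m" for m using cr(1)[of m] by (simp add: s_def)
    show "disjoint_family (\<lambda>m. ball (c m) (s m * (real m + 1)))" unfolding sr by (rule cr(2))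
    show "\<exists>q\<in>M. dist q y < s m / (real m + 1)" if "y \<in> ball (c m) (s m * (real m + 1))" for y m
      using that cr(3) unfolding sr by blast
  qed (use U in auto)
  obtain A B where AB: "bounded_linear_map (Lip0 M a) (lip_norm M)
      (Lip0 (UNIV :: 'a set) 0) (lip_norm UNIV) A"
    "bounded_linear_map (Lip0 UNIV 0) (lip_norm UNIV) (Lip0 M a) (lip_norm M) B"
    "\<And>f. f \<in> Lip0 M a \<Longrightarrow> B (A f) = f"
    by (rule Lip0_complemented_in_Lip0_UNIV[OF a, where b=0]) blast
  note CD = linf_complemented[OF a]
  show ?thesis
    by (rule pelczynski_decomposition[OF Lip0_normed_function_space Lip0_normed_function_space
          AB(1,2) _ CD(1,2)]) (erule AB(3), erule CD(3))
qed

theorem corollary3p8: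
  fixes M :: "(real ^ 'n) set" and a b :: "real ^ 'n"
  assumes "M \<in> sets lebesgue" and "emeasure lebesgue M > 0"
    and "a \<in> M"
  shows "linearly_isomorphic (Lip0 M a) (lip_norm M) (Lip0 UNIV b) (lip_norm UNIV)"
proof (rule linearly_isomorphic_cancel[OF Lip0_normed_function_space Lip0_normed_function_space
      linf_normed_function_space[OF Lip0_normed_function_space]])
  show "linearly_isomorphic (Lip0 M a) (lip_norm M)
    (linf (Lip0 (UNIV :: (real ^ 'n) set) 0) (lip_norm UNIV)) (linf_norm (lip_norm UNIV))"
    using assms by (rule Lip0_isomorphic_linf)
  show "linearly_isomorphic (Lip0 UNIV b) (lip_norm UNIV)
    (linf (Lip0 (UNIV :: (real ^ 'n) set) 0) (lip_norm UNIV)) (linf_norm (lip_norm UNIV))"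
    by (rule Lip0_isomorphic_linf) auto
qed

end
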